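(* Let $w\in S_n$ and let $(h_0,h_1,\ldots)$ be the $h$-vector of $Q_w$. Then for all $k$ we have $$h_k=\left|\{z\in\mathrm{top}_w([e,w])\mid \mathrm{asc}(z)=k\}\right|.$$
   Context: $S_n$ is the symmetric group with simple generators $s_i=(i\ i+1)$, Coxeter length $\ell$, and identity $e$. The (strong) Bruhat order $\preceq$ on $S_n$ has cover relations $x \prec xt$ whenever $t$ is a transposition with $\ell(xt)=\ell(x)+1$; write $[e,w]=\{u\mid u\preceq w\}$. The right weak order $\leq_R$ on $S_n$ has cover relations $x\lessdot_R xs$ whenever $s$ is a simple generator with $\ell(xs)=\ell(x)+1$. For $u\in S_n$ let $\boldsymbol{u}=(u^{-1}(1),\ldots,u^{-1}(n))\in\mathbb{R}^n$. The Bruhat interval polytope of $w$ is $Q_w=\mathrm{Conv}(\{\boldsymbol{u}\mid u\preceq w\})$; its vertices are exactly the points $\boldsymbol{u}$ with $u\in[e,w]$. The $h$-vector of a polytope with $f_i$ faces of dimension $i$ (nonempty faces, including the polytope itself) is defined by the polynomial identity $\sum_i f_i(x-1)^i=\sum_k h_kx^k$. For $z\in S_n$, $\mathrm{asc}(z)=n-1-|D_R(z)|$, where $D_R(z)=\{s_i\mid \ell(zs_i)<\ell(z)\}$. The normal cone of a vertex $\boldsymbol{u}$ of $Q_w$ is $C_w(\boldsymbol{u})=\{x\in\mathbb{R}^n\mid \boldsymbol{u}\in\mathrm{argmax}_{x'\in Q_w}\langle x,x'\rangle\}$. For $y\in S_n$ let $C_{w_0}(\boldsymbol{y})$ be the closed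 cone of the braid arrangement (hyperplanes $x_i=x_j$) containing $\boldsymbol{y}$ in its interior. $Q_w$ is a generalized permutohedron: each $C_w(\boldsymbol{u})$ is a union of cones $C_{w_0}(\boldsymbol{y})$. The equivalence relation $\Theta_w$ on $S_n$ is defined by $y\sim y'$ iff $C_{w_0}(\boldsymbol{y})$ and $C_{w_0}(\boldsymbol{y'})$ lie in the same cone $C_w(\boldsymbol{u})$, $u\in[e,w]$; $[y]_w$ denotes the class of $y$. Each class $[x]_w$ is an interval in right weak order, and $\mathrm{top}_w(x)$ denotes its maximum element under $\leq_R$. *)

theory Defs
  imports
    "HOL-Analysis.Analysis"
    "HOL-Computational_Algebra.Polynomial"
    "HOL-Combinatorics.Permutations"
begin

section \<open>The symmetric group and its orders\<close>

definition sym_group :: "nat \<Rightarrow> (nat \<Rightarrow> nat) set" where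
  "sym_group n = {u. u permutes {1..n}}"

definition simple_generators :: "nat \<Rightarrow> (nat \<Rightarrow> nat) set" where
  "simple_generators n = {Transposition.transpose i (i + 1) |i. 1 \<le> i \<and> i < n}"

definition transpositions :: "nat \<Rightarrow> (nat \<Rightarrow> nat) set" where
  "transpositions n =
     {Transposition.transpose a b |a b. a \<in> {1..n} \<and> b \<in> {1..n} \<and> a \<noteq> b}"

text \<open>The minimal length of an expression of \<^term>\<open>u\<close> as a product of simple generators;
  it is meaningful only for \<^term>\<open>u \<in> sym_group n\<close>.\<close>

definition coxeter_length :: "nat \<Rightarrow> (nat \<Rightarrow> nat) \<Rightarrow> nat" where
  "coxeter_length n u =
     (LEAST k. \<exists>ss. length ss = k \<and> set ss \<subseteq> simple_generators n \<and> u = foldr (\<circ>) ss id)"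

definition bruhat_cover :: "nat \<Rightarrow> (nat \<Rightarrow> nat) \<Rightarrow> (nat \<Rightarrow> nat) \<Rightarrow> bool" where
  "bruhat_cover n x y \<longleftrightarrow> x \<in> sym_group n \<and>
     (\<exists>t\<in>transpositions n. y = x \<circ> t \<and> coxeter_length n y = coxeter_length n x + 1)"

definition bruhat_le :: "nat \<Rightarrow> (nat \<Rightarrow> nat) \<Rightarrow> (nat \<Rightarrow> nat) \<Rightarrow> bool" where
  "bruhat_le n = (bruhat_cover n)\<^sup>*\<^sup>*"

definition right_weak_cover :: "nat \<Rightarrow> (nat \<Rightarrow> nat) \<Rightarrow> (nat \<Rightarrow> nat) \<Rightarrow> bool" where
  "right_weak_cover n x y \<longleftrightarrow> x \<in> sym_group n \<and>
     (\<exists>s\<in>simple_generators n. y = x \<circ> s \<and> coxeter_length n y = coxeter_length n x + 1)"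

definition right_weak_le :: "nat \<Rightarrow> (nat \<Rightarrow> nat) \<Rightarrow> (nat \<Rightarrow> nat) \<Rightarrow> bool" where
  "right_weak_le n = (right_weak_cover n)\<^sup>*\<^sup>*"

text \<open>The lower Bruhat interval from the identity to \<^term>\<open>w\<close>.\<close>

definition bruhat_below :: "nat \<Rightarrow> (nat \<Rightarrow> nat) \<Rightarrow> (nat \<Rightarrow> nat) set" where
  "bruhat_below n w = {u \<in> sym_group n. bruhat_le n u w}"

definition right_descents :: "nat \<Rightarrow> (nat \<Rightarrow> nat) \<Rightarrow> (nat \<Rightarrow> nat) set" where
  "right_descents n z =
     {s \<in> simple_generators n. coxeter_length n (z \<circ> s) < coxeter_length n z}"

text \<open>There are \<^term>\<open>n - 1\<close> simple generators, so the subtraction does not truncate when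
  \<^term>\<open>n \<ge> 1\<close>.\<close>

definition asc :: "nat \<Rightarrow> (nat \<Rightarrow> nat) \<Rightarrow> nat" where
  "asc n z = n - 1 - card (right_descents n z)"

section \<open>Faces and the h-vector of a polytope\<close>

text \<open>The empty face has affine dimension \<^term>\<open>-1\<close>, so it is never counted, whereas
  \<^term>\<open>P\<close> itself is.\<close>

definition face_number :: "'a::euclidean_space set \<Rightarrow> nat \<Rightarrow> nat" where
  "face_number P i = card {F. F face_of P \<and> aff_dim F = int i}"

definition h_polynomial :: "'a::euclidean_space set \<Rightarrow> int poly" where
  "h_polynomial P = (\<Sum>i\<le>DIM('a). of_nat (face_number P i) * [:-1, 1:] ^ i)"

definition h_vector :: "'a::euclidean_space set \<Rightarrow> nat \<Rightarrow> int" where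
  "h_vector P k = coeff (h_polynomial P) k"

section \<open>Bruhat interval polytopes\<close>

text \<open>The space of real \<^term>\<open>n\<close>-tuples is \<^typ>\<open>real ^ 'n\<close>, where a bijection
  \<^term>\<open>ix\<close> from the index type \<^typ>\<open>'n\<close> to \<^term>\<open>{1..n}\<close> numbers the coordinates.\<close>

definition perm_vec :: "('n::finite \<Rightarrow> nat) \<Rightarrow> (nat \<Rightarrow> nat) \<Rightarrow> real ^ 'n" where
  "perm_vec ix u = (\<chi> i. real (inv u (ix i)))"

definition bruhat_polytope ::
    "('n::finite \<Rightarrow> nat) \<Rightarrow> nat \<Rightarrow> (nat \<Rightarrow> nat) \<Rightarrow> (real ^ 'n) set" where
  "bruhat_polytope ix n w = convex hull (perm_vec ix ` bruhat_below n w)"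

definition normal_cone :: "'a::euclidean_space set \<Rightarrow> 'a \<Rightarrow> 'a set" where
  "normal_cone P v = {x. is_arg_max (\<lambda>x'. x \<bullet> x') (\<lambda>x'. x' \<in> P) v}"

definition braid_arrangement :: "(real ^ 'n) set set" where
  "braid_arrangement = {{x. x $ i = x $ j} |i j. i \<noteq> j}"

text \<open>The closed cones of the arrangement are the closures of the connected components of the
  complement of the hyperplanes.\<close>

definition braid_cone :: "('n::finite \<Rightarrow> nat) \<Rightarrow> (nat \<Rightarrow> nat) \<Rightarrow> (real ^ 'n) set" where
  "braid_cone ix y =
     closure (connected_component_set (- \<Union> braid_arrangement) (perm_vec ix y))"

definition same_cone ::
    "('n::finite \<Rightarrow> nat) \<Rightarrow> nat \<Rightarrow> (nat \<Rightarrow> nat) \<Rightarrow> (nat \<Rightarrow> nat) \<Rightarrow> (nat \<Rightarrow> nat) \<Rightarrow> bool" where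
  "same_cone ix n w y y' \<longleftrightarrow>
     (\<exists>u\<in>bruhat_below n w.
        braid_cone ix y \<subseteq> normal_cone (bruhat_polytope ix n w) (perm_vec ix u) \<and>
        braid_cone ix y' \<subseteq> normal_cone (bruhat_polytope ix n w) (perm_vec ix u))"

definition cone_class ::
    "('n::finite \<Rightarrow> nat) \<Rightarrow> nat \<Rightarrow> (nat \<Rightarrow> nat) \<Rightarrow> (nat \<Rightarrow> nat) \<Rightarrow> (nat \<Rightarrow> nat) set" where
  "cone_class ix n w x = {y \<in> sym_group n. same_cone ix n w x y}"

definition top_elem ::
    "('n::finite \<Rightarrow> nat) \<Rightarrow> nat \<Rightarrow> (nat \<Rightarrow> nat) \<Rightarrow> (nat \<Rightarrow> nat) \<Rightarrow> (nat \<Rightarrow> nat)" where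
  "top_elem ix n w x =
     (THE m. m \<in> cone_class ix n w x \<and> (\<forall>y\<in>cone_class ix n w x. right_weak_le n y m))"

end

theory Submission
  imports Defs
begin

text \<open>
Write a permutation \<open>u\<close> as the word \<open>u 1, \<dots>, u n\<close>. Its point has the coordinate \<open>a\<close> at the index \<open>u a\<close>,
so exchanging the entries at positions \<open>a < b\<close> moves the point along the difference of the unit vectors
at \<open>u a\<close> and \<open>u b\<close>.

The polytope is in general not simple, but it is simple in one direction: for each vertex \<open>u\<close>, the
faces on which \<open>u\<close> is the vertex closest to the identity form a Boolean lattice, with one face of
dimension \<open>card E\<close> for each set \<open>E\<close> of ascents of the top of the class of \<open>u\<close> (\<open>face_inject\<close>,
\<open>aff_dim_face\<close>). Every face has exactly one lowest vertex, so the h-polynomial is the sum over \<open>u\<close> of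
the sums of \<open>(x - 1) ^ card E\<close>, and each of these is \<open>x\<close> to the number of ascents of the top.

Two facts carry the argument. The first is that a permutation in the lower interval of \<open>w\<close> which no
exchange inside the interval improves, with respect to a generic linear functional, is unique
(\<open>local_max_unique\<close>). This follows from the lifting property of Bruhat order by induction on \<open>w\<close>. It
yields the inequalities of the normal cone at \<open>u\<close>: one for each exchange that stays below \<open>w\<close>. Hence the
class of \<open>u\<close> is the set of linear extensions of a partial order on the entries of \<open>u\<close>.

The second fact is combinatorial. If the exchange of \<open>p\<close> and \<open>r\<close> in \<open>\<dots> p \<dots> q \<dots> r \<dots>\<close> with \<open>p < q < r\<close> stays
below \<open>w\<close>, then so do the exchanges of \<open>p\<close>, \<open>q\<close> and of \<open>q\<close>, \<open>r\<close>. Since moreover every inversion of \<open>u\<close> is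
a relation, this gives the linear extensions a maximum in weak order, and forces the increasing cover
relations of the partial order to be the ascents of that maximum (\<open>adjacent_ascent_imp_R\<close>,
\<open>nonadjacent_imp_P_between\<close>). Each set \<open>E\<close> of these ascents can then be made exactly the set of ascents
at which a functional in the normal cone takes equal values (\<open>functional_with_tight_set\<close>), and the face
of that functional is spanned by the edges in \<open>E\<close> (\<open>max_face_eq\<close>).
\<close>

section \<open>Inversions and Coxeter length\<close>

definition inversions :: "nat \<Rightarrow> (nat \<Rightarrow> nat) \<Rightarrow> (nat \<times> nat) set" where
  "inversions n x = {(a, b). 1 \<le> a \<and> a < b \<and> b \<le> n \<and> x b < x a}"

lemma finite_inversions: "finite (inversions n x)"
  by (rule finite_subset[of _ "{1..n} \<times> {1..n}"]) (auto simp: inversions_def)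

lemma transpose_in_sym_group:
  "\<lbrakk>a \<in> {1..n}; b \<in> {1..n}\<rbrakk> \<Longrightarrow> Transposition.transpose a b \<in> sym_group n"
  by (simp add: sym_group_def permutes_swap_id)

lemma comp_in_sym_group: "\<lbrakk>x \<in> sym_group n; y \<in> sym_group n\<rbrakk> \<Longrightarrow> x \<circ> y \<in> sym_group n"
  by (simp add: sym_group_def permutes_compose)

lemma inj_sym_group: "x \<in> sym_group n \<Longrightarrow> inj x"
  by (simp add: sym_group_def permutes_inj)

lemma sym_group_apply_range: "\<lbrakk>x \<in> sym_group n; a \<in> {1..n}\<rbrakk> \<Longrightarrow> x a \<in> {1..n}"
  by (simp add: sym_group_def permutes_in_image del: atLeastAtMost_iff)

text \<open>Only the pair of positions \<open>(a, b)\<close> becomes a new inversion. A position between \<open>a\<close> and \<open>b\<close> holds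
a value outside the range from \<open>x a\<close> to \<open>x b\<close>, so it compares in the same way with both of these;
a position outside the interval from \<open>a\<close> to \<open>b\<close> forms one pair with \<open>a\<close> and one with \<open>b\<close>, and the
transposition exchanges these two pairs. The map \<open>f\<close> below records this.\<close>

lemma card_inversions_cover:
  assumes "inj x" "1 \<le> a" "a < b" "b \<le> n" "x a < x b"
    and none: "\<And>c. \<lbrakk>a < c; c < b\<rbrakk> \<Longrightarrow> x c < x a \<or> x b < x c"
  shows "card (inversions n (x \<circ> Transposition.transpose a b)) = card (inversions n x) + 1"
proof -
  let ?t = "Transposition.transpose a b"
  define f where "f = (\<lambda>(i, j). if i < a \<or> b < j then (?t i, ?t j) else (i, j))"
  have ne: "x c \<noteq> x d" if "c \<noteq> d" for c d using assms(1) that by (meson injD)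
  have invol: "f (f ij) = ij" if "fst ij < snd ij" for ij
    using that assms(3) by (cases ij) (auto simp: f_def Transposition.transpose_def)
  have fwd: "f ij \<in> inversions n (x \<circ> ?t) - {(a, b)}" if "ij \<in> inversions n x" for ij
  proof -
    obtain i j where ij: "ij = (i, j)" by fastforce
    have h: "1 \<le> i" "i < j" "j \<le> n" "x j < x i" using that ij by (auto simp: inversions_def)
    have n1: "x i < x a \<or> x b < x i" if "a < i" "i < b" using none that by blast
    have n2: "x j < x a \<or> x b < x j" if "a < j" "j < b" using none that by blast
    show ?thesis
      using h n1 n2 assms(2-5) unfolding ij f_def inversions_def Transposition.transpose_def
      by (auto split: if_splits)
  qed
  have bwd: "f ij \<in> inversions n x" if "ij \<in> inversions n (x \<circ> ?t) - {(a, b)}" for ij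
  proof -
    obtain i j where ij: "ij = (i, j)" by fastforce
    have h: "1 \<le> i" "i < j" "j \<le> n" "x (?t j) < x (?t i)" "(i, j) \<noteq> (a, b)"
      using that ij by (auto simp: inversions_def)
    have n1: "x i < x a \<or> x b < x i" if "a < i" "i < b" using none that by blast
    have n2: "x j < x a \<or> x b < x j" if "a < j" "j < b" using none that by blast
    show ?thesis
      using h n1 n2 assms(2-5) unfolding ij f_def inversions_def Transposition.transpose_def
      by (auto split: if_splits)
  qed
  have lt: "fst ij < snd ij" if "ij \<in> inversions n y" for ij y
    using that by (auto simp: inversions_def)
  have "bij_betw f (inversions n x) (inversions n (x \<circ> ?t) - {(a, b)})"
    by (rule bij_betw_byWitness[where f' = f])
      (use invol fwd bwd lt in \<open>auto simp: image_subset_iff simp del: split_paired_All\<close>)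
  then have "card (inversions n x) = card (inversions n (x \<circ> ?t) - {(a, b)})"
    by (rule bij_betw_same_card)
  moreover have "(a, b) \<in> inversions n (x \<circ> ?t)"
    using assms by (simp add: inversions_def)
  ultimately show ?thesis
    by (metis Suc_eq_plus1 card_Suc_Diff1 finite_inversions)
qed

lemma card_inversions_adjacent:
  assumes "inj x" "1 \<le> i" "i < n" "x i < x (i + 1)"
  shows "card (inversions n (x \<circ> Transposition.transpose i (i + 1))) = card (inversions n x) + 1"
  using assms by (intro card_inversions_cover) auto

lemma card_inversions_adjacent_descent:
  assumes "inj x" "1 \<le> i" "i < n" "x (i + 1) < x i"
  shows "card (inversions n x) = card (inversions n (x \<circ> Transposition.transpose i (i + 1))) + 1"
proof -
  let ?t = "Transposition.transpose i (i + 1)"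
  have "x \<circ> ?t \<circ> ?t = x" by (simp add: comp_assoc)
  moreover have "inj (x \<circ> ?t)" using assms(1) by (simp add: inj_compose)
  ultimately show ?thesis
    using card_inversions_adjacent[of "x \<circ> ?t" i n] assms by simp
qed

lemma permutes_increasing_imp_id:
  fixes g :: "nat \<Rightarrow> nat"
  assumes "g permutes {1..n}" and "\<And>i. \<lbrakk>1 \<le> i; i < n\<rbrakk> \<Longrightarrow> g i < g (i + 1)"
  shows "g = id"
proof -
  have "i \<le> g i" if "1 \<le> i" "i \<le> n" for i
    using that
  proof (induction i rule: dec_induct)
    case base
    then show ?case using permutes_in_image[OF assms(1), of 1] by simp
  next
    case (step i)
    then show ?case using assms(2)[of i] by simp
  qed
  then show ?thesis by (intro permutes_natset_ge[OF assms(1)]) simp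
qed

lemma sym_group_descent_exists:
  assumes "x \<in> sym_group n" "x \<noteq> id"
  obtains i where "1 \<le> i" "i < n" "x (i + 1) < x i"
proof -
  have "\<exists>i. 1 \<le> i \<and> i < n \<and> \<not> x i < x (i + 1)"
    using permutes_increasing_imp_id[of x n] assms by (auto simp: sym_group_def)
  then obtain i where i: "1 \<le> i" "i < n" "\<not> x i < x (i + 1)" by blast
  moreover have "x i \<noteq> x (i + 1)"
    using inj_sym_group[OF assms(1)] by (metis injD n_not_Suc_n Suc_eq_plus1)
  ultimately show thesis using that by force
qed

lemma foldr_comp_id: "foldr (\<circ>) ss f = foldr (\<circ>) ss id \<circ> f"
  by (induction ss) (auto simp: comp_assoc)

lemma simple_generators_in_sym_group: "simple_generators n \<subseteq> sym_group n"
  by (auto simp: simple_generators_def intro!: transpose_in_sym_group)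

lemma foldr_simple_in_sym_group:
  "set ss \<subseteq> simple_generators n \<Longrightarrow> foldr (\<circ>) ss id \<in> sym_group n"
proof (induction ss)
  case Nil
  then show ?case using permutes_id[of "{1..n}"] by (simp add: sym_group_def id_def)
next
  case (Cons s ss)
  have "s \<in> sym_group n"
    using Cons.prems simple_generators_in_sym_group[of n] by (simp add: subset_iff)
  moreover have "foldr (\<circ>) ss id \<in> sym_group n"
    by (rule Cons.IH) (use Cons.prems in simp)
  ultimately have "s \<circ> foldr (\<circ>) ss id \<in> sym_group n" by (rule comp_in_sym_group)
  then show ?case by (simp only: foldr.simps(2) comp_apply[of "(\<circ>) s" "foldr (\<circ>) ss" id])
qed

lemma card_inversions_foldr_le:
  "set ss \<subseteq> simple_generators n \<Longrightarrow> card (inversions n (foldr (\<circ>) ss id)) \<le> length ss"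
proof (induction ss rule: rev_induct)
  case Nil
  have "inversions n id = {}" by (auto simp: inversions_def)
  then show ?case by (simp add: id_def)
next
  case (snoc s ss)
  let ?x = "foldr (\<circ>) ss id"
  obtain i where i: "s = Transposition.transpose i (i + 1)" "1 \<le> i" "i < n"
    using snoc.prems by (auto simp: simple_generators_def)
  have inj: "inj ?x" using snoc.prems foldr_simple_in_sym_group inj_sym_group by auto
  then have "?x i \<noteq> ?x (i + 1)" by (metis injD n_not_Suc_n Suc_eq_plus1)
  then have "card (inversions n (?x \<circ> s)) \<le> card (inversions n ?x) + 1"
    using card_inversions_adjacent[OF inj i(2,3)] card_inversions_adjacent_descent[OF inj i(2,3)] i(1)
    by (cases "?x i < ?x (i + 1)") auto
  moreover have "foldr (\<circ>) (ss @ [s]) id = ?x \<circ> s"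
    using foldr_comp_id[of ss s]
    by (simp only: foldr_append foldr.simps comp_apply[of "(\<circ>) s"] id_apply comp_id)
  moreover have "card (inversions n ?x) \<le> length ss"
    by (rule snoc.IH) (use snoc.prems in simp)
  moreover have "length (ss @ [s]) = length ss + 1" by simp
  ultimately show ?case by (simp only:)
qed

text \<open>Bubble sort: exchanging the entries at a descent removes exactly one inversion, and only the identity
has no descent.\<close>

lemma reduced_word_exists:
  assumes "x \<in> sym_group n"
  shows "\<exists>ss. length ss = card (inversions n x) \<and> set ss \<subseteq> simple_generators n \<and> x = foldr (\<circ>) ss id"
  using assms
proof (induction "card (inversions n x)" arbitrary: x rule: less_induct)
  case less
  show ?case
  proof (cases "x = id")
    case True
    moreover have "inversions n id = {}" by (auto simp: inversions_def)
    ultimately show ?thesis by (intro exI[of _ "[]"]) simp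
  next
    case False
    then obtain i where i: "1 \<le> i" "i < n" "x (i + 1) < x i"
      using sym_group_descent_exists less.prems by blast
    let ?t = "Transposition.transpose i (i + 1)"
    have t: "?t \<in> simple_generators n" using i by (auto simp: simple_generators_def)
    then have xt: "x \<circ> ?t \<in> sym_group n"
      using less.prems comp_in_sym_group simple_generators_in_sym_group by blast
    have c: "card (inversions n x) = card (inversions n (x \<circ> ?t)) + 1"
      using card_inversions_adjacent_descent[OF inj_sym_group[OF less.prems] i] .
    then obtain ss where ss: "length ss = card (inversions n (x \<circ> ?t))"
        "set ss \<subseteq> simple_generators n" "x \<circ> ?t = foldr (\<circ>) ss id"
      using less.hyps[OF _ xt] by auto
    have "x = x \<circ> ?t \<circ> ?t" by (simp add: comp_assoc)
    also have "\<dots> = foldr (\<circ>) (ss @ [?t]) id"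
      using ss(3) foldr_comp_id[of ss ?t] by simp
    finally show ?thesis using ss c t by (intro exI[of _ "ss @ [?t]"]) simp
  qed
qed

lemma coxeter_length_eq_card_inversions:
  assumes "x \<in> sym_group n"
  shows "coxeter_length n x = card (inversions n x)"
  unfolding coxeter_length_def
proof (rule Least_equality)
  show "\<exists>ss. length ss = card (inversions n x) \<and> set ss \<subseteq> simple_generators n \<and> x = foldr (\<circ>) ss id"
    using reduced_word_exists[OF assms] .
qed (use card_inversions_foldr_le in blast)

section \<open>Bruhat order by reflections, and the lifting property\<close>

text \<open>Bruhat order is also generated by all transpositions that put a larger entry in front of a smaller one,
whether or not they are covers. These steps behave better than covers under left multiplication by a
simple generator, which is what the lifting property needs.\<close>

definition reflection_step :: "nat \<Rightarrow> (nat \<Rightarrow> nat) \<Rightarrow> (nat \<Rightarrow> nat) \<Rightarrow> bool" where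
  "reflection_step n x y \<longleftrightarrow> x \<in> sym_group n \<and>
     (\<exists>a b. 1 \<le> a \<and> a < b \<and> b \<le> n \<and> x a < x b \<and> y = x \<circ> Transposition.transpose a b)"

lemma bruhat_cover_of_no_between:
  assumes "x \<in> sym_group n" "1 \<le> a" "a < b" "b \<le> n" "x a < x b"
    and "\<And>c. \<lbrakk>a < c; c < b\<rbrakk> \<Longrightarrow> x c < x a \<or> x b < x c"
  shows "bruhat_cover n x (x \<circ> Transposition.transpose a b)"
proof -
  have t: "Transposition.transpose a b \<in> transpositions n"
    unfolding transpositions_def using assms(2-4)
    by (intro CollectI exI[of _ a] exI[of _ b]) auto
  have "x \<circ> Transposition.transpose a b \<in> sym_group n"
    using assms by (intro comp_in_sym_group transpose_in_sym_group) auto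
  then show ?thesis unfolding bruhat_cover_def
    using card_inversions_cover[OF inj_sym_group[OF assms(1)] assms(2-6)] assms(1) t
    by (auto simp: coxeter_length_eq_card_inversions)
qed

text \<open>If no entry lies between in position and in value, the transposition is a cover. Otherwise choose
such an entry; the pattern \<open>p q r\<close> formed by it becomes \<open>r q p\<close> along \<open>p q r\<close>, \<open>q p r\<close>, \<open>r p q\<close>,
\<open>r q p\<close>, and each of these three exchanges has fewer entries between.\<close>

lemma bruhat_le_transpose:
  assumes "x \<in> sym_group n" "1 \<le> a" "a < b" "b \<le> n" "x a < x b"
  shows "bruhat_le n x (x \<circ> Transposition.transpose a b)"
  using assms
proof (induction "card {c. a < c \<and> c < b \<and> x a < x c \<and> x c < x b}" arbitrary: x a b rule: less_induct)
  case less
  let ?B = "\<lambda>(x :: nat \<Rightarrow> nat) a b. {c. a < c \<and> c < b \<and> x a < x c \<and> x c < x b}"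
  let ?T = "Transposition.transpose"
  have inj: "x c \<noteq> x d" if "c \<noteq> d" for c d
    using inj_sym_group[OF less.prems(1)] that by (meson injD)
  have fin: "finite (?B x a b)" for x a b
    by (rule finite_subset[of _ "{a..b}"]) auto
  show ?case
  proof (cases "?B x a b = {}")
    case True
    have "x c < x a \<or> x b < x c" if "a < c" "c < b" for c
    proof -
      have "c \<notin> ?B x a b" using True by blast
      moreover have "x c \<noteq> x a" "x c \<noteq> x b" using that inj[of c a] inj[of c b] by simp_all
      ultimately show ?thesis using that by auto
    qed
    then show ?thesis
      using bruhat_cover_of_no_between less.prems by (simp add: bruhat_le_def r_into_rtranclp)
  next
    case False
    then obtain c where c: "a < c" "c < b" "x a < x c" "x c < x b" by blast
    define y where "y = x \<circ> ?T a c"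
    define z where "z = y \<circ> ?T a b"
    have ty: "y \<in> sym_group n" unfolding y_def
      using less.prems c by (intro comp_in_sym_group transpose_in_sym_group) auto
    have tz: "z \<in> sym_group n" unfolding z_def
      using less.prems c ty by (intro comp_in_sym_group transpose_in_sym_group) auto
    have "card (?B x a c) < card (?B x a b)"
      by (rule psubset_card_mono[OF fin]) (use c in auto)
    then have 1: "bruhat_le n x y"
      unfolding y_def using c less.prems by (intro less.hyps) linarith+
    have yv: "y a = x c" "y c = x a" "y b = x b" "\<And>d. d \<noteq> a \<Longrightarrow> d \<noteq> c \<Longrightarrow> y d = x d"
      using c by (auto simp: y_def)
    have zv: "z a = x b" "z c = x a" "z b = x c" "\<And>d. d \<noteq> a \<Longrightarrow> d \<noteq> c \<Longrightarrow> d \<noteq> b \<Longrightarrow> z d = x d"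
      using c yv by (auto simp: z_def)
    have "card (?B y a b) < card (?B x a b)"
    proof (rule psubset_card_mono[OF fin])
      have "d \<in> ?B x a b - {c}" if "d \<in> ?B y a b" for d
        using that c yv by (cases "d = c") auto
      then show "?B y a b \<subset> ?B x a b" using c by blast
    qed
    then have 2: "bruhat_le n y z"
      unfolding z_def by (rule less.hyps[OF _ ty]) (use less.prems c yv(1,3) in linarith)+
    have "card (?B z c b) < card (?B x a b)"
    proof (rule psubset_card_mono[OF fin])
      have "d \<in> ?B x a b - {c}" if "d \<in> ?B z c b" for d
        using that c zv by auto
      then show "?B z c b \<subset> ?B x a b" using c by blast
    qed
    then have 3: "bruhat_le n z (z \<circ> ?T c b)"
      by (rule less.hyps[OF _ tz]) (use less.prems c zv(2,3) in linarith)+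
    have "z \<circ> ?T c b = x \<circ> ?T a b"
      using c by (auto simp: z_def y_def Transposition.transpose_def fun_eq_iff)
    with 1 2 3 show ?thesis by (simp add: bruhat_le_def)
  qed
qed

lemma bruhat_le_length:
  assumes "bruhat_le n x y"
  shows "x = y \<or> coxeter_length n x < coxeter_length n y"
  using assms unfolding bruhat_le_def
  by (induction rule: rtranclp_induct) (auto simp: bruhat_cover_def)

lemma bruhat_le_trans: "\<lbrakk>bruhat_le n x y; bruhat_le n y z\<rbrakk> \<Longrightarrow> bruhat_le n x z"
  by (simp add: bruhat_le_def)

lemma bruhat_cover_imp_reflection_step:
  assumes "bruhat_cover n x y"
  shows "reflection_step n x y"
proof -
  obtain a0 b0 where *: "x \<in> sym_group n" "a0 \<in> {1..n}" "b0 \<in> {1..n}" "a0 \<noteq> b0"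
      "y = x \<circ> Transposition.transpose a0 b0" "coxeter_length n y = coxeter_length n x + 1"
    using assms by (auto simp: bruhat_cover_def transpositions_def)
  define a b where "a = min a0 b0" and "b = max a0 b0"
  have ab: "1 \<le> a" "a < b" "b \<le> n" "y = x \<circ> Transposition.transpose a b"
    using * by (auto simp: a_def b_def min_def max_def transpose_commute)
  have "x a < x b"
  proof (rule ccontr)
    assume "\<not> x a < x b"
    moreover have "x a \<noteq> x b" using ab inj_sym_group[OF *(1)] by (metis injD less_irrefl)
    ultimately have "y a < y b" using ab by simp
    moreover have "y \<in> sym_group n" using * ab
      by (auto intro!: comp_in_sym_group transpose_in_sym_group)
    ultimately have "bruhat_le n y (y \<circ> Transposition.transpose a b)"
      using ab bruhat_le_transpose by blast
    moreover have "y \<circ> Transposition.transpose a b = x" by (simp add: ab comp_assoc)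
    ultimately show False using bruhat_le_length *(6) by fastforce
  qed
  with ab *(1) show ?thesis by (auto simp: reflection_step_def)
qed

lemma bruhat_le_iff_reflection_steps: "bruhat_le n x y \<longleftrightarrow> (reflection_step n)\<^sup>*\<^sup>* x y"
proof
  show "bruhat_le n x y \<Longrightarrow> (reflection_step n)\<^sup>*\<^sup>* x y"
    unfolding bruhat_le_def using bruhat_cover_imp_reflection_step by (metis mono_rtranclp)
  show "(reflection_step n)\<^sup>*\<^sup>* x y \<Longrightarrow> bruhat_le n x y"
  proof (induction rule: rtranclp_induct)
    case base
    then show ?case by (simp add: bruhat_le_def)
  next
    case (step y z)
    then obtain a b where "y \<in> sym_group n" "1 \<le> a" "a < b" "b \<le> n" "y a < y b"
        "z = y \<circ> Transposition.transpose a b"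
      unfolding reflection_step_def by blast
    then have "bruhat_le n y z" by (simp only: bruhat_le_transpose)
    with step.IH show ?case by (rule bruhat_le_trans)
  qed
qed

text \<open>Left multiplication by \<open>s\<close> exchanges the values \<open>i\<close> and \<open>i + 1\<close>. It preserves the comparison of two
entries unless they are \<open>i\<close> and \<open>i + 1\<close> themselves, and then the step from \<open>x\<close> to \<open>y\<close> is
multiplication by \<open>s\<close>.\<close>

lemma reflection_step_left_simple:
  assumes "reflection_step n x y" "1 \<le> i" "i < n"
  defines "s \<equiv> Transposition.transpose i (i + 1)"
  shows "y = s \<circ> x \<or> reflection_step n (s \<circ> x) (s \<circ> y)"
proof -
  obtain a b where ab: "x \<in> sym_group n" "1 \<le> a" "a < b" "b \<le> n" "x a < x b"
      "y = x \<circ> Transposition.transpose a b"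
    using assms(1) by (auto simp: reflection_step_def)
  have s: "s \<in> sym_group n" using assms(2,3) by (auto simp: s_def intro: transpose_in_sym_group)
  show ?thesis
  proof (cases "x a = i \<and> x b = i + 1")
    case True
    have "inj x" using ab inj_sym_group by blast
    have "y c = s (x c)" for c
    proof -
      have "x c = x a \<longleftrightarrow> c = a" "x c = x b \<longleftrightarrow> c = b"
        using \<open>inj x\<close> by (simp_all add: inj_eq)
      then show ?thesis using True unfolding ab(6) s_def Transposition.transpose_def by simp
    qed
    then have "y = s \<circ> x" by (simp add: fun_eq_iff)
    then show ?thesis by simp
  next
    case False
    then have "s (x a) < s (x b)"
      using ab(5) by (auto simp: s_def Transposition.transpose_def)
    then have "reflection_step n (s \<circ> x) (s \<circ> y)"
      using ab s comp_in_sym_group unfolding reflection_step_def by (auto simp: comp_assoc)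
    then show ?thesis by simp
  qed
qed

text \<open>This is used when \<open>s \<circ> w\<close> is below \<open>w\<close>. Then the first statement says that the lower interval of \<open>w\<close>
is stable under \<open>s\<close>, and the second says that an element \<open>z\<close> of it that goes up under \<open>s\<close> is already
below \<open>s \<circ> w\<close>.\<close>

lemma bruhat_lift:
  assumes "bruhat_le n z w" "1 \<le> i" "i < n"
  defines "s \<equiv> Transposition.transpose i (i + 1)"
  shows "bruhat_le n (s \<circ> z) w \<or> bruhat_le n (s \<circ> z) (s \<circ> w)"
    and "bruhat_le n z (s \<circ> w) \<or> bruhat_le n (s \<circ> z) (s \<circ> w)"
proof -
  have ss: "s \<circ> (s \<circ> x) = x" for x :: "nat \<Rightarrow> nat" by (simp add: s_def fun_eq_iff)
  let ?le = "(reflection_step n)\<^sup>*\<^sup>*"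
  have "(?le (s \<circ> z) w \<or> ?le (s \<circ> z) (s \<circ> w)) \<and> (?le z (s \<circ> w) \<or> ?le (s \<circ> z) (s \<circ> w))"
    using assms(1) unfolding bruhat_le_iff_reflection_steps
  proof (induction rule: converse_rtranclp_induct)
    case base
    then show ?case by simp
  next
    case (step x y)
    from reflection_step_left_simple[OF step(1) assms(2,3)]
    consider "y = s \<circ> x" | "reflection_step n (s \<circ> x) (s \<circ> y)" by (auto simp: s_def)
    then show ?case
    proof cases
      case 1
      then have "s \<circ> y = x" by (simp only: ss)
      then show ?thesis using step(2,3) 1 by (simp only: disj_commute) blast
    next
      case 2
      then show ?thesis using step(1,3) converse_rtranclp_into_rtranclp[of "reflection_step n"]
        by blast
    qed
  qed
  then show "bruhat_le n (s \<circ> z) w \<or> bruhat_le n (s \<circ> z) (s \<circ> w)"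
    and "bruhat_le n z (s \<circ> w) \<or> bruhat_le n (s \<circ> z) (s \<circ> w)"
    by (simp_all add: bruhat_le_iff_reflection_steps)
qed

section \<open>Right weak order and ascents\<close>

text \<open>The permutation \<open>inv v \<circ> y\<close> lists the positions in \<open>v\<close> of the successive entries of \<open>y\<close>. As long as it
is not the identity it has a descent, which by the hypothesis is an ascent of \<open>y\<close>. Exchanging the two
entries is an upward step in weak order and preserves the hypothesis.\<close>

lemma right_weak_le_of_inversions:
  assumes "y \<in> sym_group n" "v \<in> sym_group n"
    and "\<And>a b. \<lbrakk>1 \<le> a; a < b; b \<le> n; y b < y a\<rbrakk> \<Longrightarrow> inv v (y a) < inv v (y b)"
  shows "right_weak_le n y v"
  using assms
proof (induction "card (inversions n (inv v \<circ> y))" arbitrary: y rule: less_induct)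
  case less
  let ?g = "inv v \<circ> y"
  have v: "v permutes {1..n}" using less.prems by (simp add: sym_group_def)
  have g: "?g \<in> sym_group n"
    using less.prems(1) permutes_inv[OF v] by (simp add: comp_in_sym_group sym_group_def permutes_compose)
  show ?case
  proof (cases "?g = id")
    case True
    then have "v \<circ> (inv v \<circ> y) = v" by simp
    then have "y = v" using permutes_surj[OF v] by (simp add: fun_eq_iff surj_f_inv_f)
    then show ?thesis by (simp add: right_weak_le_def)
  next
    case False
    then obtain i where i: "1 \<le> i" "i < n" "?g (i + 1) < ?g i"
      using sym_group_descent_exists g by blast
    let ?s = "Transposition.transpose i (i + 1)"
    have inj: "inj y" using less.prems inj_sym_group by blast
    have yi: "y i < y (i + 1)"
      using less.prems(3)[of i "i + 1"] i inj
      by (metis (mono_tags, lifting) Suc_eq_plus1 Suc_leI comp_apply injD lessI linorder_neqE_nat n_not_Suc_n not_less_iff_gr_or_eq)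
    have ys: "y \<circ> ?s \<in> sym_group n"
      using less.prems i by (intro comp_in_sym_group transpose_in_sym_group) auto
    have "card (inversions n (inv v \<circ> (y \<circ> ?s))) < card (inversions n ?g)"
      using card_inversions_adjacent_descent[OF inj_sym_group[OF g] i] unfolding comp_assoc by linarith
    moreover have "inv v ((y \<circ> ?s) a) < inv v ((y \<circ> ?s) b)"
      if "1 \<le> a" "a < b" "b \<le> n" "(y \<circ> ?s) b < (y \<circ> ?s) a" for a b
    proof (cases "a = i \<and> b = i + 1")
      case True
      then show ?thesis using i(3) by simp
    next
      case False
      then have "?s a < ?s b" "1 \<le> ?s a" "?s b \<le> n"
        using that i by (auto simp: Transposition.transpose_def)
      then show ?thesis using less.prems(3) that(4) by simp
    qed
    ultimately have "right_weak_le n (y \<circ> ?s) v"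
      using less.hyps[of "y \<circ> ?s"] ys less.prems(2) by blast
    moreover have "right_weak_cover n y (y \<circ> ?s)"
      using less.prems(1) ys i card_inversions_adjacent[OF inj i(1,2) yi]
      by (auto simp: right_weak_cover_def simple_generators_def coxeter_length_eq_card_inversions)
    ultimately show ?thesis
      by (simp add: right_weak_le_def converse_rtranclp_into_rtranclp)
  qed
qed

lemma right_weak_le_antisym:
  assumes "right_weak_le n x y" "right_weak_le n y x"
  shows "x = y"
proof -
  have "x = y \<or> coxeter_length n x < coxeter_length n y" if "right_weak_le n x y" for x y
    using that unfolding right_weak_le_def
    by (induction rule: rtranclp_induct) (auto simp: right_weak_cover_def)
  from this[OF assms(1)] this[OF assms(2)] show ?thesis by auto
qed

lemma asc_eq_card_ascents:
  assumes "v \<in> sym_group n"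
  shows "asc n v = card {k. 1 \<le> k \<and> k < n \<and> v k < v (k + 1)}"
proof -
  let ?s = "\<lambda>i. Transposition.transpose i (i + 1)"
  let ?D = "{i. 1 \<le> i \<and> i < n \<and> v (i + 1) < v i}"
  let ?A = "{k. 1 \<le> k \<and> k < n \<and> v k < v (k + 1)}"
  have inj: "inj v" using assms inj_sym_group by blast
  have ne: "v i \<noteq> v (i + 1)" for i using inj by (metis injD n_not_Suc_n Suc_eq_plus1)
  have len: "coxeter_length n (v \<circ> ?s i) < coxeter_length n v \<longleftrightarrow> v (i + 1) < v i"
    if "1 \<le> i" "i < n" for i
  proof -
    have "v \<circ> ?s i \<in> sym_group n"
      using that assms by (intro comp_in_sym_group transpose_in_sym_group) auto
    then show ?thesis
      using ne[of i] card_inversions_adjacent[OF inj that] card_inversions_adjacent_descent[OF inj that] assms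
      by (cases "v i < v (i + 1)") (auto simp: coxeter_length_eq_card_inversions)
  qed
  have "right_descents n v = ?s ` ?D"
    using len by (auto simp: right_descents_def simple_generators_def)
  moreover have "inj_on ?s ?D"
  proof (rule inj_onI)
    fix i j :: nat assume "?s i = ?s j"
    then have "?s i i = ?s j i" "?s j j = ?s i j" by (simp_all only:)
    then show "i = j" by (simp add: Transposition.transpose_def split: if_splits)
  qed
  ultimately have "card (right_descents n v) = card ?D" by (simp add: card_image)
  moreover have "card ({1..<n}) = card ?A + card ?D"
  proof -
    have "{1..<n} = ?A \<union> ?D" using ne by (auto simp: neq_iff)
    moreover have "finite ?A" "finite ?D" by (rule finite_subset[of _ "{1..<n}"]; auto)+
    moreover have "?A \<inter> ?D = {}" by auto
    ultimately show ?thesis using card_Un_disjoint[of ?A ?D] by (simp only:)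
  qed
  ultimately show ?thesis by (simp add: asc_def)
qed

section \<open>Locally maximal elements of a lower Bruhat interval\<close>

lemma finite_bruhat_below: "finite (bruhat_below n w)"
proof (rule finite_subset)
  show "bruhat_below n w \<subseteq> {u. u permutes {1..n}}"
    by (auto simp: bruhat_below_def sym_group_def)
qed (simp add: finite_permutations)

lemma self_in_bruhat_below: "w \<in> sym_group n \<Longrightarrow> w \<in> bruhat_below n w"
  by (simp add: bruhat_below_def bruhat_le_def)

text \<open>These exchanges move the point of \<open>u\<close> along directions that generate the cone which the Bruhat
interval polytope spans at this vertex; see \<open>normal_cone_iff\<close>.\<close>

definition swap_below :: "nat \<Rightarrow> (nat \<Rightarrow> nat) \<Rightarrow> (nat \<Rightarrow> nat) \<Rightarrow> nat \<Rightarrow> nat \<Rightarrow> bool" where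
  "swap_below n w u a b \<longleftrightarrow>
     1 \<le> a \<and> a < b \<and> b \<le> n \<and> u \<circ> Transposition.transpose a b \<in> bruhat_below n w"

lemma swap_in_sym_group:
  "\<lbrakk>u \<in> sym_group n; 1 \<le> a; a < b; b \<le> n\<rbrakk> \<Longrightarrow> u \<circ> Transposition.transpose a b \<in> sym_group n"
  by (intro comp_in_sym_group transpose_in_sym_group) auto

lemma bruhat_le_transpose_descent:
  assumes "u \<in> sym_group n" "1 \<le> a" "a < b" "b \<le> n" "u b < u a"
  shows "bruhat_le n (u \<circ> Transposition.transpose a b) u"
proof -
  let ?t = "Transposition.transpose a b"
  have "bruhat_le n (u \<circ> ?t) (u \<circ> ?t \<circ> ?t)"
    using assms by (intro bruhat_le_transpose swap_in_sym_group) auto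
  then show ?thesis by (simp add: comp_assoc)
qed

lemma swap_below_descent:
  assumes "u \<in> bruhat_below n w" "1 \<le> a" "a < b" "b \<le> n" "u b < u a"
  shows "swap_below n w u a b"
proof -
  have u: "u \<in> sym_group n" "bruhat_le n u w" using assms(1) by (simp_all add: bruhat_below_def)
  have "bruhat_le n (u \<circ> Transposition.transpose a b) w"
    using bruhat_le_trans[OF bruhat_le_transpose_descent[OF u(1) assms(2-5)] u(2)] .
  then show ?thesis
    using swap_in_sym_group[OF u(1) assms(2-4)] assms by (simp add: swap_below_def bruhat_below_def)
qed

text \<open>For values \<open>p < q < r\<close>, the words \<open>q p r\<close> and \<open>p r q\<close> are below \<open>r q p\<close>.\<close>

lemma swap_below_between:
  assumes "u \<in> sym_group n" "swap_below n w u a b" "a < c" "c < b" "u a < u c" "u c < u b"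
  shows "swap_below n w u a c" "swap_below n w u c b"
proof -
  let ?T = "Transposition.transpose"
  have ab: "1 \<le> a" "a < b" "b \<le> n" "bruhat_le n (u \<circ> ?T a b) w"
    using assms(2) by (simp_all add: swap_below_def bruhat_below_def)
  have "bruhat_le n (u \<circ> ?T a c) (u \<circ> ?T a b)"
  proof -
    define y where "y = u \<circ> ?T a c"
    define z where "z = y \<circ> ?T a b"
    have y: "y \<in> sym_group n" using assms ab by (auto simp only: y_def intro!: swap_in_sym_group)
    have z: "z \<in> sym_group n" using y assms ab by (auto simp only: z_def intro!: swap_in_sym_group)
    have "bruhat_le n y z" unfolding z_def using assms ab
      by (intro bruhat_le_transpose[OF y]) (auto simp: y_def)
    moreover have "bruhat_le n z (z \<circ> ?T c b)" using assms ab
      by (intro bruhat_le_transpose[OF z]) (auto simp: y_def z_def)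
    moreover have "z \<circ> ?T c b = u \<circ> ?T a b"
      using assms by (auto simp: z_def y_def Transposition.transpose_def fun_eq_iff)
    ultimately show ?thesis unfolding y_def using bruhat_le_trans by metis
  qed
  then show "swap_below n w u a c"
    using assms ab swap_in_sym_group[of u n a c] bruhat_le_trans[OF _ ab(4)]
    by (simp add: swap_below_def bruhat_below_def)
  have "bruhat_le n (u \<circ> ?T c b) (u \<circ> ?T a b)"
  proof -
    define y where "y = u \<circ> ?T c b"
    define z where "z = y \<circ> ?T a b"
    have y: "y \<in> sym_group n" using assms ab by (auto simp only: y_def intro!: swap_in_sym_group)
    have z: "z \<in> sym_group n" using y assms ab by (auto simp only: z_def intro!: swap_in_sym_group)
    have "bruhat_le n y z" unfolding z_def using assms ab
      by (intro bruhat_le_transpose[OF y]) (auto simp: y_def)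
    moreover have "bruhat_le n z (z \<circ> ?T a c)" using assms ab
      by (intro bruhat_le_transpose[OF z]) (auto simp: y_def z_def)
    moreover have "z \<circ> ?T a c = u \<circ> ?T a b"
      using assms by (auto simp: z_def y_def Transposition.transpose_def fun_eq_iff)
    ultimately show ?thesis unfolding y_def using bruhat_le_trans by metis
  qed
  then show "swap_below n w u c b"
    using assms ab swap_in_sym_group[of u n c b] bruhat_le_trans[OF _ ab(4)]
    by (simp add: swap_below_def bruhat_below_def)
qed

text \<open>By \<open>pairing_transpose\<close>, these strict inequalities say that each exchange of entries that stays
below \<open>w\<close> decreases the inner product with \<open>x\<close>.\<close>

definition local_max :: "nat \<Rightarrow> (nat \<Rightarrow> nat) \<Rightarrow> (nat \<Rightarrow> real) \<Rightarrow> (nat \<Rightarrow> nat) \<Rightarrow> bool" where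
  "local_max n w x u \<longleftrightarrow>
     u \<in> bruhat_below n w \<and> (\<forall>a b. swap_below n w u a b \<longrightarrow> x (u a) < x (u b))"

lemma transpose_comp_eq_comp_transpose:
  assumes "u \<in> sym_group n"
  shows "Transposition.transpose i j \<circ> u = u \<circ> Transposition.transpose (inv u i) (inv u j)"
proof -
  have u: "u permutes {1..n}" using assms by (simp add: sym_group_def)
  have "a = inv u k \<longleftrightarrow> u a = k" for a k using permutes_inv_eq[OF u] by metis
  then show ?thesis
    by (simp add: fun_eq_iff Transposition.transpose_def permutes_inverses[OF u])
qed

text \<open>This is why local optimality implies global optimality on the interval. Let \<open>s\<close> exchange the values
\<open>i\<close> and \<open>i + 1\<close> and let \<open>s \<circ> w\<close> be shorter than \<open>w\<close>. If \<open>x i < x (i + 1)\<close>, a local maximum has \<open>i\<close>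
in front of \<open>i + 1\<close>, so by the lifting property it is below \<open>s \<circ> w\<close>, and induction applies. If
\<open>x i > x (i + 1)\<close>, multiplication by \<open>s\<close> maps the interval to itself and the local maxima for \<open>x\<close> to
those for \<open>x \<circ> s\<close>, which is the first case.\<close>

lemma local_max_unique:
  assumes "w \<in> sym_group n" "local_max n w x u" "local_max n w x u'"
  shows "u = u'"
  using assms
proof (induction "coxeter_length n w" arbitrary: w x u u' rule: less_induct)
  case less
  show ?case
  proof (cases "w = id")
    case True
    have "z = id" if "bruhat_le n z id" "z \<in> sym_group n" for z
    proof -
      have "inversions n id = {}" by (auto simp: inversions_def)
      then have "coxeter_length n id = 0"
        using less.prems(1) True coxeter_length_eq_card_inversions[of id n] by simp
      then show ?thesis using bruhat_le_length[OF that(1)] by simp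
    qed
    then have "u = id" "u' = id" using less.prems True by (simp_all add: local_max_def bruhat_below_def)
    then show ?thesis by simp
  next
    case False
    have wp: "w permutes {1..n}" using less.prems(1) by (simp add: sym_group_def)
    have "inv w \<in> sym_group n" "inv w \<noteq> id"
      using wp False permutes_inv[OF wp] permutes_inv_inv[OF wp] by (auto simp: sym_group_def)
    then obtain i where i: "1 \<le> i" "i < n" "inv w (i + 1) < inv w i"
      using sym_group_descent_exists by blast
    define s where "s = Transposition.transpose i (i + 1)"
    have s: "s \<in> sym_group n" using i by (auto simp: s_def intro: transpose_in_sym_group)
    have ss: "s \<circ> (s \<circ> f) = f" for f :: "nat \<Rightarrow> nat" by (simp add: s_def fun_eq_iff)
    have inv_rng: "1 \<le> inv z j" "inv z j \<le> n"
      if "z \<in> sym_group n" "1 \<le> j" "j \<le> n" for z j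
      using that permutes_in_image[OF permutes_inv, of z "{1..n}" j] by (auto simp: sym_group_def)
    have inv_app: "z (inv z j) = j" if "z \<in> sym_group n" for z j
      using that by (simp add: sym_group_def permutes_inverses)
    have swap: "s \<circ> z = z \<circ> Transposition.transpose (inv z (i + 1)) (inv z i)"
      if "z \<in> sym_group n" for z
      using transpose_comp_eq_comp_transpose[OF that] by (simp add: s_def transpose_commute)
    have sw: "s \<circ> w \<in> sym_group n" using less.prems(1) s comp_in_sym_group by blast
    have sw_le: "bruhat_le n (s \<circ> w) w"
      unfolding swap[OF less.prems(1)]
      by (rule bruhat_le_transpose_descent[OF less.prems(1)])
        (use i inv_rng[OF less.prems(1)] inv_app[OF less.prems(1)] in auto)
    have "s \<circ> w \<noteq> w"
    proof
      assume "s \<circ> w = w"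
      then have "s (w (inv w i)) = w (inv w i)" by (metis comp_apply)
      then show False using inv_app[OF less.prems(1)] by (simp add: s_def)
    qed
    then have len: "coxeter_length n (s \<circ> w) < coxeter_length n w"
      using bruhat_le_length[OF sw_le] by simp
    \<comment> \<open>With \<open>i + 1\<close> in front of \<open>i\<close>, exchanging the two would be an improvement; so \<open>z\<close> goes up under \<open>s\<close>.\<close>
    have down: "local_max n (s \<circ> w) x z" if x: "x i < x (i + 1)" and z: "local_max n w x z" for x z
    proof -
      have zS: "z \<in> sym_group n" "bruhat_le n z w"
        using z by (simp_all add: local_max_def bruhat_below_def)
      have "inv z i < inv z (i + 1)"
      proof (rule ccontr)
        assume "\<not> inv z i < inv z (i + 1)"
        moreover have "inv z i \<noteq> inv z (i + 1)" using inv_app[OF zS(1)] by (metis n_not_Suc_n Suc_eq_plus1)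
        ultimately have "inv z (i + 1) < inv z i" by simp
        then have "swap_below n w z (inv z (i + 1)) (inv z i)"
          using z i inv_rng[OF zS(1)] inv_app[OF zS(1)]
          by (intro swap_below_descent) (auto simp: local_max_def)
        then show False using z x inv_app[OF zS(1)] by (fastforce simp: local_max_def)
      qed
      then have "bruhat_le n z (s \<circ> z)"
        unfolding swap[OF zS(1)] transpose_commute[of "inv z (i + 1)"]
        by (intro bruhat_le_transpose[OF zS(1)]) (use i inv_rng[OF zS(1)] inv_app[OF zS(1)] in auto)
      then have "bruhat_le n z (s \<circ> w)"
        using bruhat_lift(2)[OF zS(2) i(1,2)] bruhat_le_trans unfolding s_def by blast
      moreover have "swap_below n w z a b" if "swap_below n (s \<circ> w) z a b" for a b
        using that bruhat_le_trans[OF _ sw_le] by (simp add: swap_below_def bruhat_below_def)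
      ultimately show ?thesis using z zS by (simp add: local_max_def bruhat_below_def)
    qed
    have uniq: "z = z'" if "x i < x (i + 1)" "local_max n w x z" "local_max n w x z'" for x z z'
      using less.hyps[OF len sw down down] that by blast
    have up: "s \<circ> z \<in> bruhat_below n w" if "z \<in> bruhat_below n w" for z
      using that bruhat_lift(1)[of n z w i] i bruhat_le_trans[OF _ sw_le] comp_in_sym_group[OF s]
      unfolding bruhat_below_def s_def by blast
    \<comment> \<open>The symmetry \<open>s\<close> of the interval reduces the opposite inequality to the first case.\<close>
    have flip: "local_max n w (x \<circ> s) (s \<circ> z)" if z: "local_max n w x z" for z
    proof -
      have "swap_below n w z a b" if "swap_below n w (s \<circ> z) a b" for a b
      proof -
        have "s \<circ> (s \<circ> z \<circ> Transposition.transpose a b) \<in> bruhat_below n w"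
          using that up by (simp only: swap_below_def)
        then have "z \<circ> Transposition.transpose a b \<in> bruhat_below n w"
          by (simp only: comp_assoc ss)
        then show ?thesis using that by (simp add: swap_below_def)
      qed
      moreover have "(x \<circ> s) ((s \<circ> z) a) = x (z a)" for a by (simp add: s_def)
      ultimately show ?thesis using z up by (simp only: local_max_def) blast
    qed
    have "x i \<noteq> x (i + 1)"
    proof -
      have u: "u \<in> bruhat_below n w" and uS: "u \<in> sym_group n"
        using less.prems(2) by (simp_all add: local_max_def bruhat_below_def)
      let ?a = "inv u i" and ?b = "inv u (i + 1)"
      have ne: "?a \<noteq> ?b" using inv_app[OF uS] by (metis n_not_Suc_n Suc_eq_plus1)
      have r: "1 \<le> ?a" "?a \<le> n" "1 \<le> ?b" "?b \<le> n" using inv_rng[OF uS] i by auto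
      have "swap_below n w u (min ?a ?b) (max ?a ?b)"
        using up[OF u] swap[OF uS] r ne
        by (auto simp: swap_below_def min_def max_def transpose_commute)
      then have "x (u (min ?a ?b)) < x (u (max ?a ?b))"
        using less.prems(2) by (simp add: local_max_def)
      then show ?thesis using inv_app[OF uS] by (auto simp: min_def max_def split: if_splits)
    qed
    then consider "x i < x (i + 1)" | "(x \<circ> s) i < (x \<circ> s) (i + 1)"
      by (auto simp: s_def neq_iff)
    then show ?thesis
    proof cases
      case 1
      then show ?thesis using uniq less.prems by blast
    next
      case 2
      then have "s \<circ> u = s \<circ> u'" using uniq flip less.prems by blast
      then show ?thesis using ss by metis
    qed
  qed
qed

text \<open>The inner product of the point of \<open>u\<close> with the vector \<open>x\<close>, summed over positions instead of values.\<close>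

definition pairing :: "nat \<Rightarrow> (nat \<Rightarrow> real) \<Rightarrow> (nat \<Rightarrow> nat) \<Rightarrow> real" where
  "pairing n x u = (\<Sum>a\<in>{1..n}. x (u a) * real a)"

lemma pairing_transpose:
  assumes "1 \<le> a" "a < b" "b \<le> n"
  shows "pairing n x (u \<circ> Transposition.transpose a b) =
    pairing n x u + (real b - real a) * (x (u a) - x (u b))"
proof -
  let ?t = "Transposition.transpose a b"
  have split: "(\<Sum>c\<in>{1..n}. g c) = g a + g b + (\<Sum>c\<in>{1..n} - {a, b}. g c)" for g :: "nat \<Rightarrow> real"
    using assms by (subst sum.subset_diff[of "{a, b}"]) auto
  have "(\<Sum>c\<in>{1..n} - {a, b}. x ((u \<circ> ?t) c) * real c) = (\<Sum>c\<in>{1..n} - {a, b}. x (u c) * real c)"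
    by (rule sum.cong) auto
  then show ?thesis unfolding pairing_def split using assms by (simp add: algebra_simps)
qed

lemma local_max_of_max:
  assumes "inj_on x {1..n}" "u \<in> bruhat_below n w"
    and "\<And>z. z \<in> bruhat_below n w \<Longrightarrow> pairing n x z \<le> pairing n x u"
  shows "local_max n w x u"
  unfolding local_max_def
proof (intro conjI allI impI)
  fix a b assume sb: "swap_below n w u a b"
  then have ab: "1 \<le> a" "a < b" "b \<le> n" by (simp_all add: swap_below_def)
  have "(real b - real a) * (x (u a) - x (u b)) \<le> 0"
    using assms(3)[of "u \<circ> Transposition.transpose a b"] sb pairing_transpose[OF ab, of x u]
    by (simp add: swap_below_def)
  then have "x (u a) \<le> x (u b)" using ab by (simp add: mult_le_0_iff)
  moreover have "x (u a) \<noteq> x (u b)"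
  proof -
    have uS: "u \<in> sym_group n" using assms(2) by (simp add: bruhat_below_def)
    have "u a \<noteq> u b" using inj_sym_group[OF uS] ab by (simp add: inj_eq)
    moreover have "u a \<in> {1..n}" "u b \<in> {1..n}" using sym_group_apply_range[OF uS] ab by auto
    ultimately show ?thesis using assms(1) by (meson inj_onD)
  qed
  ultimately show "x (u a) < x (u b)" by simp
qed (rule assms(2))

lemma local_max_is_max:
  assumes "w \<in> sym_group n" "inj_on x {1..n}" "local_max n w x u" "z \<in> bruhat_below n w"
  shows "pairing n x z \<le> pairing n x u"
proof -
  let ?B = "bruhat_below n w"
  have fin: "finite (pairing n x ` ?B)" using finite_bruhat_below by blast
  have "Max (pairing n x ` ?B) \<in> pairing n x ` ?B"
    using fin assms(4) by (intro Max_in) auto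
  then obtain m where m: "m \<in> ?B" "pairing n x m = Max (pairing n x ` ?B)" by auto
  then have max: "pairing n x z \<le> pairing n x m" if "z \<in> ?B" for z
    using Max_ge[OF fin] that by simp
  have "m = u" using local_max_unique[OF assms(1) local_max_of_max[OF assms(2) m(1)] assms(3)] max by blast
  then show ?thesis using max assms(4) by blast
qed

lemma local_max_exists:
  assumes "w \<in> sym_group n" "inj_on x {1..n}"
  obtains u where "local_max n w x u"
proof -
  let ?B = "bruhat_below n w"
  have fin: "finite (pairing n x ` ?B)" using finite_bruhat_below by blast
  have "Max (pairing n x ` ?B) \<in> pairing n x ` ?B"
    using fin self_in_bruhat_below[OF assms(1)] by (intro Max_in) auto
  then obtain m where m: "m \<in> ?B" "pairing n x m = Max (pairing n x ` ?B)" by auto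
  then have "pairing n x z \<le> pairing n x m" if "z \<in> ?B" for z
    using Max_ge[OF fin] that by simp
  then show thesis using that local_max_of_max[OF assms(2) m(1)] by blast
qed

lemma eventually_perturbation_keeps_less:
  fixes x g :: "nat \<Rightarrow> real"
  shows "\<forall>\<^sub>F e in at_right 0. \<forall>p\<in>{1..n}. \<forall>q\<in>{1..n}. x p < x q \<longrightarrow> x p + e * g p < x q + e * g q"
proof (intro eventually_ball_finite ballI finite_atLeastAtMost)
  fix p q
  show "\<forall>\<^sub>F e in at_right 0. x p < x q \<longrightarrow> x p + e * g p < x q + e * g q"
  proof (cases "x p < x q")
    case True
    have "((\<lambda>e. (x q + e * g q) - (x p + e * g p)) \<longlongrightarrow>
        (x q + 0 * g q) - (x p + 0 * g p)) (at_right 0)"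
      by (intro tendsto_intros)
    then have "\<forall>\<^sub>F e in at_right 0. 0 < (x q + e * g q) - (x p + e * g p)"
      by (rule order_tendstoD(1)) (use True in simp)
    then show ?thesis by (rule eventually_mono) simp
  qed simp
qed

lemma pairing_add: "pairing n (\<lambda>k. x k + e * g k) u = pairing n x u + e * pairing n g u"
  by (simp add: pairing_def algebra_simps sum.distrib sum_distrib_left)

text \<open>Adding a small multiple of \<open>inv u\<close> to \<open>x\<close> makes the values distinct and all the inequalities strict,
because \<open>inv u\<close> takes the value \<open>a\<close> at \<open>u a\<close>. Then \<open>u\<close> is the local, hence the global, maximum; let
the multiple tend to \<open>0\<close>.\<close>

lemma local_inequalities_imp_max:
  assumes "w \<in> sym_group n" "u \<in> bruhat_below n w"
    and mono: "\<And>a b. swap_below n w u a b \<Longrightarrow> x (u a) \<le> x (u b)"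
    and "z \<in> bruhat_below n w"
  shows "pairing n x z \<le> pairing n x u"
proof -
  define g where "g k = real (inv u k)" for k
  have up: "u permutes {1..n}" using assms(2) by (simp add: bruhat_below_def sym_group_def)
  have gu: "g (u a) = real a" for a using up by (simp add: g_def permutes_inverses)
  have ginj: "g p \<noteq> g q" if "p \<noteq> q" for p q
    using that permutes_inj[OF permutes_inv[OF up]] by (simp add: g_def inj_eq)
  have "\<forall>\<^sub>F e in at_right 0. pairing n x z + e * pairing n g z \<le> pairing n x u + e * pairing n g u"
    using eventually_perturbation_keeps_less[of n x g] eventually_at_right_less[of "0 :: real"]
  proof eventually_elim
    case (elim e)
    let ?y = "\<lambda>k. x k + e * g k"
    have inj: "inj_on ?y {1..n}"
    proof (rule inj_onI, rule ccontr)
      fix p q assume pq: "p \<in> {1..n}" "q \<in> {1..n}" "?y p = ?y q" "p \<noteq> q"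
      then have "x p = x q" using elim(1) by (metis less_irrefl neq_iff)
      then show False using pq elim(2) ginj by auto
    qed
    have "?y (u a) < ?y (u b)" if sb: "swap_below n w u a b" for a b
    proof -
      have ab: "1 \<le> a" "a < b" "b \<le> n" using sb by (simp_all add: swap_below_def)
      have "u a \<in> {1..n}" "u b \<in> {1..n}" using permutes_in_image[OF up] ab by auto
      show ?thesis
      proof (cases "x (u a) = x (u b)")
        case True
        then show ?thesis using elim(2) ab gu by simp
      next
        case False
        with mono[OF sb] have "x (u a) < x (u b)" by simp
        then show ?thesis using elim(1) \<open>u a \<in> {1..n}\<close> \<open>u b \<in> {1..n}\<close> by blast
      qed
    qed
    then have "local_max n w ?y u" using assms(2) by (simp add: local_max_def)
    from local_max_is_max[OF assms(1) inj this assms(4)] show ?case by (simp only: pairing_add)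
  qed
  moreover have "((\<lambda>e. pairing n x z + e * pairing n g z) \<longlongrightarrow> pairing n x z + 0 * pairing n g z) (at_right 0)"
    "((\<lambda>e. pairing n x u + e * pairing n g u) \<longlongrightarrow> pairing n x u + 0 * pairing n g u) (at_right 0)"
    by (intro tendsto_intros)+
  ultimately have "pairing n x z + 0 * pairing n g z \<le> pairing n x u + 0 * pairing n g u"
    by (intro tendsto_le[of "at_right 0"]) auto
  then show ?thesis by simp
qed

section \<open>The poset at a vertex and its topmost linear extension\<close>

text \<open>The elements are the positions of \<open>u\<close>, and \<open>R\<close> stands for the exchanges that stay below \<open>w\<close>. The
transitive closure \<open>P\<close> is a partial order whose linear extensions, written as words in the
corresponding values, form the class of \<open>u\<close>. The three axioms on \<open>R\<close> suffice to show that the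
linear extensions have a maximum in right weak order, and that the increasing cover relations of \<open>P\<close>
are exactly the ascents of that maximum.\<close>

locale interval_poset =
  fixes n :: nat and u :: "nat \<Rightarrow> nat" and R :: "nat \<Rightarrow> nat \<Rightarrow> bool"
  assumes u_perm: "u \<in> sym_group n"
    and R_range: "R a b \<Longrightarrow> 1 \<le> a \<and> a < b \<and> b \<le> n"
    and R_descent: "\<lbrakk>1 \<le> a; a < b; b \<le> n; u b < u a\<rbrakk> \<Longrightarrow> R a b"
    and R_between: "\<lbrakk>R a b; a < c; c < b; u a < u c; u c < u b\<rbrakk> \<Longrightarrow> R a c \<and> R c b"
begin

abbreviation P :: "nat \<Rightarrow> nat \<Rightarrow> bool" where "P \<equiv> R\<^sup>+\<^sup>+"

text \<open>The order of two entries in the topmost extension: increasing pairs only where \<open>P\<close> forces them,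
decreasing pairs wherever \<open>P\<close> permits them.\<close>

definition before :: "nat \<Rightarrow> nat \<Rightarrow> bool" where
  "before a b \<longleftrightarrow> (if u a < u b then P a b else u b < u a \<and> \<not> P b a)"

definition top_pos :: "nat \<Rightarrow> nat" where
  "top_pos a = card {b \<in> {1..n}. b = a \<or> before b a}"

abbreviation entry :: "nat \<Rightarrow> nat" where "entry k \<equiv> inv_into {1..n} top_pos k"

definition top_perm :: "nat \<Rightarrow> nat" where
  "top_perm k = (if k \<in> {1..n} then u (entry k) else k)"

lemma u_inj: "u a = u b \<longleftrightarrow> a = b"
  using inj_sym_group[OF u_perm] by (simp add: inj_eq)

lemma P_range: "P a b \<Longrightarrow> 1 \<le> a \<and> a < b \<and> b \<le> n"
  by (induction rule: tranclp_induct) (use R_range in fastforce)+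

text \<open>Depending on whether the position \<open>c\<close> is before \<open>a\<close>, between \<open>a\<close> and \<open>b\<close>, or after \<open>b\<close>, the relation
comes from the inversion at \<open>(c, a)\<close>, from the axiom on intermediate entries, or from the inversion at
\<open>(b, c)\<close>.\<close>

lemma P_separate_R:
  assumes "R a b" "u a < u c" "u c < u b"
  shows "P a c \<or> P c b"
proof -
  have ab: "1 \<le> a" "a < b" "b \<le> n" using R_range[OF assms(1)] by auto
  have "c \<in> {1..n}"
  proof (rule ccontr)
    assume "c \<notin> {1..n}"
    then have "u c = c" using u_perm by (simp add: sym_group_def permutes_not_in)
    then show False using assms(2,3) \<open>c \<notin> {1..n}\<close> sym_group_apply_range[OF u_perm, of b] ab by auto
  qed
  moreover have "c \<noteq> a" "c \<noteq> b" using assms by auto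
  ultimately consider "1 \<le> c" "c < a" | "a < c" "c < b" | "b < c" "c \<le> n" by force
  then show ?thesis
  proof cases
    case 1
    then have "R c a" using R_descent ab assms by simp
    then show ?thesis
      using assms(1) tranclp.trancl_into_trancl[OF tranclp.r_into_trancl, of R] by blast
  next
    case 2
    then show ?thesis using R_between assms by blast
  next
    case 3
    then have "R b c" using R_descent ab assms by simp
    then show ?thesis
      using assms(1) tranclp.trancl_into_trancl[OF tranclp.r_into_trancl, of R] by blast
  qed
qed

text \<open>Along a chain of relations from \<open>a\<close> to \<open>b\<close>, the values pass from below \<open>u c\<close> to above it, either by
meeting \<open>c\<close> or in a single relation, to which the preceding lemma applies. This makes the
increasing pairs outside \<open>P\<close> a transitive relation, as is needed for \<open>before\<close> to be a linear order.\<close>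

lemma P_separate:
  assumes "P a b" "u a < u c" "u c < u b"
  shows "P a c \<or> P c b"
  using assms
proof (induction arbitrary: c rule: tranclp_induct)
  case (base b)
  then show ?case by (rule P_separate_R)
next
  case (step b d)
  consider "u c < u b" | "c = b" | "u b < u c" using u_inj by (metis neq_iff)
  then show ?case
  proof cases
    case 1
    then have "P a c \<or> P c b" using step by blast
    then show ?thesis using step(2) tranclp.trancl_into_trancl[of R] by blast
  next
    case 2
    then show ?thesis using step(1) by blast
  next
    case 3
    then have "P b c \<or> P c d" using P_separate_R step by blast
    then show ?thesis using step(1) tranclp_trans[of R] by blast
  qed
qed

lemma before_total: "a \<noteq> b \<Longrightarrow> before a b \<longleftrightarrow> \<not> before b a"
  using u_inj[of a b] by (auto simp: before_def)

lemma before_irrefl: "\<not> before a a"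
  by (simp add: before_def)

lemma before_trans:
  assumes "before a b" "before b c"
  shows "before a c"
proof (rule ccontr)
  assume "\<not> before a c"
  moreover have "a \<noteq> c" using assms before_total before_irrefl by metis
  ultimately have ca: "before c a" using before_total by blast
  \<comment> \<open>A cycle, read from its smallest value onwards, is impossible.\<close>
  have cyc: False if "before a b" "before b c" "before c a" "u a < u b" "u a < u c" for a b c
  proof (cases "u b < u c")
    case True
    then have "P a b" "P b c" "\<not> P a c" using that by (simp_all add: before_def)
    then show False using tranclp_trans[of R] by blast
  next
    case False
    moreover have "u b \<noteq> u c" using that before_irrefl u_inj by metis
    ultimately have "u c < u b" by simp
    then have "P a b" "\<not> P c b" "\<not> P a c" using that by (simp_all add: before_def)
    then show False using P_separate[of a b c] that(5) \<open>u c < u b\<close> by blast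
  qed
  have ne: "u a \<noteq> u b" "u b \<noteq> u c" "u a \<noteq> u c"
    using assms ca before_irrefl u_inj by metis+
  consider "u a < u b" "u a < u c" | "u b < u c" "u b < u a" | "u c < u a" "u c < u b"
    using ne by linarith
  then show False using cyc assms ca by cases blast+
qed

lemma P_imp_before: "P a b \<Longrightarrow> before a b"
  using P_range[of a b] P_range[of b a] u_inj[of a b] by (auto simp: before_def)

lemma top_pos_less:
  assumes "a \<in> {1..n}" "b \<in> {1..n}"
  shows "top_pos a < top_pos b \<longleftrightarrow> before a b"
proof -
  have less: "top_pos a < top_pos b" if "before a b" "b \<in> {1..n}" for a b
    unfolding top_pos_def
  proof (rule psubset_card_mono)
    have "b \<notin> {c \<in> {1..n}. c = a \<or> before c a}"
      using that before_total[of a b] before_irrefl[of b] by blast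
    moreover have "{c \<in> {1..n}. c = a \<or> before c a} \<subseteq> {c \<in> {1..n}. c = b \<or> before c b}"
      using that before_trans by blast
    ultimately show "{c \<in> {1..n}. c = a \<or> before c a} \<subset> {c \<in> {1..n}. c = b \<or> before c b}"
      using that(2) by blast
  qed simp
  show ?thesis
    using less[of a b] less[of b a] assms before_total[of a b] before_irrefl by (cases "a = b") auto
qed

lemma bij_top_pos: "bij_betw top_pos {1..n} {1..n}"
proof -
  have inj: "inj_on top_pos {1..n}"
  proof (rule inj_onI, rule ccontr)
    fix a b assume "a \<in> {1..n}" "b \<in> {1..n}" "top_pos a = top_pos b" "a \<noteq> b"
    then show False using top_pos_less before_total by (metis less_irrefl)
  qed
  have "top_pos a \<in> {1..n}" if "a \<in> {1..n}" for a
  proof -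
    let ?S = "{b \<in> {1..n}. b = a \<or> before b a}"
    have "card ?S \<le> card {1..n}" by (rule card_mono) auto
    moreover have "0 < card ?S" using that by (auto simp: card_gt_0_iff)
    ultimately show ?thesis unfolding top_pos_def by simp
  qed
  then have "top_pos ` {1..n} = {1..n}"
    using inj by (intro endo_inj_surj) auto
  with inj show ?thesis by (simp add: bij_betw_def)
qed

lemma entry_range: "k \<in> {1..n} \<Longrightarrow> entry k \<in> {1..n}"
  using bij_top_pos by (metis bij_betw_def inv_into_into)

lemma top_pos_entry: "k \<in> {1..n} \<Longrightarrow> top_pos (entry k) = k"
  using bij_top_pos by (metis bij_betw_def f_inv_into_f)

lemma entry_top_pos: "a \<in> {1..n} \<Longrightarrow> entry (top_pos a) = a"
  using bij_top_pos by (metis bij_betw_def inv_into_f_f)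

lemma top_pos_range: "a \<in> {1..n} \<Longrightarrow> top_pos a \<in> {1..n}"
  using bij_top_pos by (metis bij_betwE)

lemma top_perm_in_sym_group: "top_perm \<in> sym_group n"
proof -
  have "bij_betw (u \<circ> inv_into {1..n} top_pos) {1..n} {1..n}"
    using u_perm bij_betw_inv_into[OF bij_top_pos]
    by (intro bij_betw_trans) (auto simp: sym_group_def permutes_imp_bij)
  then have "bij_betw top_perm {1..n} {1..n}"
    by (rule bij_betw_cong[THEN iffD1, rotated]) (simp add: top_perm_def)
  then show ?thesis
    unfolding sym_group_def by (auto intro!: bij_imp_permutes simp: top_perm_def)
qed

lemma top_perm_top_pos: "a \<in> {1..n} \<Longrightarrow> top_perm (top_pos a) = u a"
  using top_pos_range[of a] entry_top_pos[of a] by (simp only: top_perm_def if_True)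

lemma inv_top_perm: "a \<in> {1..n} \<Longrightarrow> inv top_perm (u a) = top_pos a"
  using top_perm_top_pos[of a] top_perm_in_sym_group
  by (metis inj_sym_group inv_f_f)

lemma P_top_pos_less:
  assumes "P a b"
  shows "top_pos a < top_pos b"
  using P_range[OF assms] P_imp_before[OF assms] top_pos_less by simp

text \<open>Two adjacent entries of a linear extension can be related only by a cover relation, and the cover
relations of a transitive closure belong to the generating relation.\<close>

lemma adjacent_ascent_imp_R:
  assumes "a \<in> {1..n}" "b \<in> {1..n}" "top_pos b = top_pos a + 1" "u a < u b"
  shows "R a b"
proof -
  have "before a b" using assms top_pos_less[of a b] by simp
  then have "P a b" using assms(4) by (simp add: before_def)
  then obtain c where c: "R a c" "R\<^sup>*\<^sup>* c b" using tranclpD[of R] by blast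
  have "\<not> P c b"
  proof
    assume "P c b"
    then have "top_pos a < top_pos c" "top_pos c < top_pos b"
      using P_top_pos_less c(1) by blast+
    then show False using assms(3) by simp
  qed
  then show ?thesis using c by (metis rtranclpD)
qed

text \<open>An increasing cover relation of \<open>P\<close> from \<open>a\<close> to \<open>b\<close> joins adjacent entries of the topmost extension.
Otherwise the entries in between have values below \<open>u a\<close> or above \<open>u b\<close>, since the rest would be
intermediate in \<open>P\<close>. The first of them is not large, since increasing relations from \<open>a\<close> to \<open>b\<close> and to
a larger entry would relate these two, which either contradicts their order in the extension or gives
an intermediate element; symmetrically the last is not small. So somewhere a small entry is followed by
a large one. That ascent is in \<open>R\<close>. If the small entry precedes \<open>a\<close> in \<open>u\<close>, the axiom on intermediate
entries puts it in front of \<open>a\<close> in the extension, which is false; if it follows \<open>a\<close>, it is intermediate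
between \<open>a\<close> and \<open>b\<close>.\<close>

lemma nonadjacent_imp_P_between:
  assumes ab: "P a b" "u a < u b" and far: "top_pos a + 1 < top_pos b"
  shows "\<exists>c. P a c \<and> P c b"
proof (rule ccontr)
  assume none: "\<not> ?thesis"
  have rng: "1 \<le> a" "a < b" "b \<le> n" using P_range[OF ab(1)] by auto
  have pr: "1 \<le> top_pos a" "top_pos b \<le> n" using top_pos_range[of a] top_pos_range[of b] rng by auto
  have out: "u (entry k) < u a \<or> u b < u (entry k)" if k: "top_pos a < k" "k < top_pos b" for k
  proof (rule ccontr)
    assume neg: "\<not> ?thesis"
    let ?c = "entry k"
    have c: "?c \<in> {1..n}" "top_pos ?c = k" using entry_range top_pos_entry k pr by auto
    then have "before a ?c" "before ?c b" using top_pos_less[of a ?c] top_pos_less[of ?c b] k rng by auto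
    moreover have "?c \<noteq> a" "?c \<noteq> b" using c k by auto
    then have "u ?c \<noteq> u a" "u ?c \<noteq> u b" using u_inj by auto
    then have "u a < u ?c" "u ?c < u b" using neg by auto
    ultimately have "P a ?c" "P ?c b" by (simp_all add: before_def)
    then show False using none by blast
  qed
  have first: "u (entry (top_pos a + 1)) < u a"
  proof (rule ccontr)
    let ?g = "entry (top_pos a + 1)"
    assume "\<not> u ?g < u a"
    then have big: "u b < u ?g" using out[of "top_pos a + 1"] far by simp
    have g: "?g \<in> {1..n}" "top_pos ?g = top_pos a + 1"
      using entry_range[of "top_pos a + 1"] top_pos_entry[of "top_pos a + 1"] far pr by auto
    have ag: "R a ?g" using adjacent_ascent_imp_R[of a ?g] g rng ab big by simp
    have "\<not> ?g < b"
    proof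
      assume "?g < b"
      then have "R ?g b" using R_descent[of ?g b] g rng big by simp
      then show False using none ag by blast
    qed
    moreover have "?g \<noteq> b" using big by auto
    ultimately have "b < ?g" by simp
    then have "R b ?g" using R_between[OF ag, of b] rng ab big by simp
    then have "top_pos b < top_pos ?g" using P_top_pos_less by blast
    then show False using g far by simp
  qed
  have last: "u b < u (entry (top_pos b - 1))"
  proof (rule ccontr)
    let ?s = "entry (top_pos b - 1)"
    assume "\<not> u b < u ?s"
    then have small: "u ?s < u a" using out[of "top_pos b - 1"] far by force
    have rg: "top_pos b - 1 \<in> {1..n}" using far pr by auto
    have s: "?s \<in> {1..n}" "top_pos ?s = top_pos b - 1"
      using entry_range[OF rg] top_pos_entry[OF rg] by (simp_all only:)
    have sb: "R ?s b" using adjacent_ascent_imp_R[of ?s b] s rng ab small far by simp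
    have "\<not> a < ?s"
    proof
      assume "a < ?s"
      then have "R a ?s" using R_descent[of a ?s] s rng small by simp
      then show False using none sb by blast
    qed
    moreover have "?s \<noteq> a" using small by auto
    ultimately have "?s < a" by simp
    then have "R ?s a" using R_between[OF sb, of a] rng ab small by simp
    then have "top_pos ?s < top_pos a" using P_top_pos_less by blast
    then show False using s far by simp
  qed
  have "\<exists>k. top_pos a < k \<and> k + 1 < top_pos b \<and> u (entry k) < u a \<and> u b < u (entry (k + 1))"
  proof (rule ccontr)
    assume no: "\<not> ?thesis"
    have "u (entry k) < u a" if "top_pos a + 1 \<le> k" "k \<le> top_pos b - 1" for k
      using that
    proof (induction k rule: dec_induct)
      case base
      then show ?case using first by simp
    next
      case (step k)
      then have "u (entry k) < u a" "top_pos a < k" "k + 1 < top_pos b" by auto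
      then have "\<not> u b < u (entry (k + 1))" using no by blast
      then show ?case using out[of "Suc k"] step by auto
    qed
    moreover have "top_pos a + 1 \<le> top_pos b - 1" using far by linarith
    ultimately have "u (entry (top_pos b - 1)) < u a" by blast
    then show False using last ab(2) by linarith
  qed
  then obtain k where k: "top_pos a < k" "k + 1 < top_pos b" "u (entry k) < u a" "u b < u (entry (k + 1))"
    by blast
  let ?s = "entry k" and ?g = "entry (k + 1)"
  have s: "?s \<in> {1..n}" "top_pos ?s = k" using entry_range top_pos_entry k pr by auto
  have g: "?g \<in> {1..n}" "top_pos ?g = k + 1"
    using entry_range[of "k + 1"] top_pos_entry[of "k + 1"] k pr by auto
  have sg: "R ?s ?g" using adjacent_ascent_imp_R[of ?s ?g] s g k ab by simp
  have "before ?s b" "before a ?g"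
    using top_pos_less[of ?s b] top_pos_less[of a ?g] s g rng k by auto
  then have sb: "P ?s b" and ag: "P a ?g" using k ab by (simp_all add: before_def)
  have "?s \<noteq> a" using k by auto
  then consider "?s < a" | "a < ?s" by linarith
  then show False
  proof cases
    case 1
    then have "R ?s a" using R_between[OF sg, of a] P_range[OF ag] k ab by simp
    then have "top_pos ?s < top_pos a" using P_top_pos_less by blast
    then show False using s k by simp
  next
    case 2
    then have "R a ?s" using R_descent[of a ?s] s rng k by simp
    then show False using none sb by blast
  qed
qed

text \<open>A weakly monotone labelling of the poset that is strict on decreasing relations can identify two
related elements only through a run of consecutive ascents of the topmost extension: by the preceding
lemma a nonadjacent pair splits at an intermediate element with the same label.\<close>

lemma ascent_run_of_equality:
  fixes c :: "nat \<Rightarrow> real"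
  assumes mono: "\<And>a b. R a b \<Longrightarrow> c (u a) \<le> c (u b)"
    and strict: "\<And>a b. \<lbrakk>R a b; c (u a) = c (u b)\<rbrakk> \<Longrightarrow> u a < u b"
    and "P a b" "c (u a) = c (u b)" "top_pos a \<le> k" "k < top_pos b"
  shows "top_perm k < top_perm (k + 1) \<and> c (top_perm k) = c (top_perm (k + 1))"
  using assms(3-)
proof (induction "top_pos b - top_pos a" arbitrary: a b rule: less_induct)
  case less
  have P_mono: "c (u a) \<le> c (u b) \<and> (c (u a) = c (u b) \<longrightarrow> u a < u b)" if "P a b" for a b
    using that
  proof (induction rule: tranclp_induct)
    case (base b)
    then show ?case using mono strict by blast
  next
    case (step b d)
    have "c (u b) \<le> c (u d)" "c (u b) = c (u d) \<Longrightarrow> u b < u d" using mono strict step(2) by blast+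
    then show ?case using step.IH by auto
  qed
  have lt: "u a < u b" using P_mono less.prems by blast
  have rng: "a \<in> {1..n}" "b \<in> {1..n}" using P_range[OF less.prems(1)] by auto
  show ?case
  proof (cases "top_pos a + 1 < top_pos b")
    case True
    then obtain d where d: "P a d" "P d b" using nonadjacent_imp_P_between less.prems(1) lt by blast
    have eq: "c (u a) = c (u d)" "c (u d) = c (u b)"
      using P_mono[OF d(1)] P_mono[OF d(2)] less.prems(2) by auto
    have pos: "top_pos a < top_pos d" "top_pos d < top_pos b" using d P_top_pos_less by blast+
    show ?thesis
    proof (cases "k < top_pos d")
      case True
      show ?thesis by (rule less.hyps[OF _ d(1) eq(1)]) (use pos True less.prems in auto)
    next
      case False
      show ?thesis by (rule less.hyps[OF _ d(2) eq(2)]) (use pos False less.prems in auto)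
    qed
  next
    case False
    then have "top_pos a = k" "top_pos b = k + 1" using less.prems by auto
    then have "top_perm k = u a" "top_perm (k + 1) = u b"
      using top_perm_top_pos rng by metis+
    then show ?thesis using lt less.prems by simp
  qed
qed

text \<open>A pair that is inverted in a linear extension \<open>y\<close> is not an increasing relation of \<open>P\<close>, hence it is
inverted in the topmost extension.\<close>

lemma right_weak_le_top_perm:
  assumes "y \<in> sym_group n" and ext: "\<And>a b. R a b \<Longrightarrow> inv y (u a) < inv y (u b)"
  shows "right_weak_le n y top_perm"
proof (rule right_weak_le_of_inversions[OF assms(1) top_perm_in_sym_group])
  fix i j assume ij: "1 \<le> i" "i < j" "j \<le> n" "y j < y i"
  have up: "u permutes {1..n}" using u_perm by (simp add: sym_group_def)
  define a b where "a = inv u (y i)" and "b = inv u (y j)"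
  have "y i \<in> {1..n}" "y j \<in> {1..n}" using sym_group_apply_range[OF assms(1)] ij by auto
  then have rng: "a \<in> {1..n}" "b \<in> {1..n}"
    unfolding a_def b_def using permutes_in_image[OF permutes_inv[OF up]] by blast+
  have ua: "u a = y i" "u b = y j" using permutes_inverses[OF up] by (simp_all add: a_def b_def)
  have ext_P: "inv y (u a) < inv y (u b)" if "P a b" for a b
    using that by (induction rule: tranclp_induct) (use ext in \<open>auto intro: less_trans\<close>)
  have "inv y (y i) = i" "inv y (y j) = j"
    using inj_sym_group[OF assms(1)] by simp_all
  then have "\<not> P b a" using ext_P[of b a] ua ij by auto
  then have "before a b" using ua ij by (simp add: before_def)
  then show "inv top_perm (y i) < inv top_perm (y j)"
    using inv_top_perm rng top_pos_less ua by metis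
qed

end

section \<open>Normal cones of the Bruhat interval polytope\<close>

lemma interval_poset_swap_below:
  assumes "u \<in> bruhat_below n w"
  shows "interval_poset n u (swap_below n w u)"
proof
  show u: "u \<in> sym_group n" using assms by (simp add: bruhat_below_def)
  show "1 \<le> a \<and> a < b \<and> b \<le> n" if "swap_below n w u a b" for a b
    using that by (simp add: swap_below_def)
  show "swap_below n w u a b" if "1 \<le> a" "a < b" "b \<le> n" "u b < u a" for a b
    using swap_below_descent assms that by blast
  show "swap_below n w u a c \<and> swap_below n w u c b"
    if "swap_below n w u a b" "a < c" "c < b" "u a < u c" "u c < u b" for a b c
    using swap_below_between[OF u] that by blast
qed

locale bruhat_polytope_coords =
  fixes ix :: "'n::finite \<Rightarrow> nat" and n :: nat and w :: "nat \<Rightarrow> nat"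
  assumes bij_ix: "bij_betw ix (UNIV :: 'n set) {1..n}"
    and w_perm: "w \<in> sym_group n"
begin

abbreviation B :: "(nat \<Rightarrow> nat) set" where "B \<equiv> bruhat_below n w"
abbreviation Q :: "(real ^ 'n) set" where "Q \<equiv> bruhat_polytope ix n w"
abbreviation pv :: "(nat \<Rightarrow> nat) \<Rightarrow> real ^ 'n" where "pv \<equiv> perm_vec ix"
abbreviation R :: "(nat \<Rightarrow> nat) \<Rightarrow> nat \<Rightarrow> nat \<Rightarrow> bool" where "R \<equiv> swap_below n w"

definition coords :: "real ^ 'n \<Rightarrow> nat \<Rightarrow> real" where
  "coords x k = x $ inv_into UNIV ix k"

definition vec_of :: "(nat \<Rightarrow> real) \<Rightarrow> real ^ 'n" where
  "vec_of f = (\<chi> i. f (ix i))"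

definition class_top :: "(nat \<Rightarrow> nat) \<Rightarrow> nat \<Rightarrow> nat" where
  "class_top u = interval_poset.top_perm n u (R u)"

lemma B_sym_group: "u \<in> B \<Longrightarrow> u \<in> sym_group n"
  by (simp add: bruhat_below_def)

lemma R_range: "R u a b \<Longrightarrow> 1 \<le> a \<and> a < b \<and> b \<le> n"
  by (simp add: swap_below_def)

lemma R_values_range: "\<lbrakk>u \<in> B; R u a b\<rbrakk> \<Longrightarrow> u a \<in> {1..n} \<and> u b \<in> {1..n}"
  using R_range[of u a b] sym_group_apply_range[OF B_sym_group] by auto

lemma ix_inv: "k \<in> {1..n} \<Longrightarrow> ix (inv_into UNIV ix k) = k"
  using bij_ix by (metis bij_betw_def f_inv_into_f)

lemma inv_ix: "inv_into UNIV ix (ix i) = i"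
  using bij_ix by (simp add: bij_betw_def)

lemma card_index: "CARD('n) = n"
  using bij_betw_same_card[OF bij_ix] by simp

lemma coords_vec_of: "k \<in> {1..n} \<Longrightarrow> coords (vec_of f) k = f k"
  using ix_inv by (simp add: coords_def vec_of_def)

lemma coords_perm_vec: "k \<in> {1..n} \<Longrightarrow> coords (pv y) k = real (inv y k)"
  using ix_inv by (simp add: coords_def perm_vec_def)

lemma coords_add_scaled: "coords (x + e *\<^sub>R y) = (\<lambda>k. coords x k + e * coords y k)"
  by (simp add: coords_def fun_eq_iff)

lemma inner_perm_vec:
  assumes "u \<in> sym_group n"
  shows "x \<bullet> pv u = pairing n (coords x) u"
proof -
  have up: "u permutes {1..n}" using assms by (simp add: sym_group_def)
  have "x \<bullet> pv u = (\<Sum>i\<in>UNIV. coords x (ix i) * real (inv u (ix i)))"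
    by (simp add: inner_vec_def perm_vec_def coords_def inv_ix)
  also have "\<dots> = (\<Sum>k\<in>{1..n}. coords x k * real (inv u k))"
    by (rule sum.reindex_bij_betw[OF bij_ix])
  also have "\<dots> = (\<Sum>a\<in>{1..n}. coords x (u a) * real (inv u (u a)))"
    by (rule sum.reindex_bij_betw[OF permutes_imp_bij[OF up], symmetric])
  also have "\<dots> = pairing n (coords x) u"
    by (simp add: pairing_def permutes_inverses[OF up])
  finally show ?thesis .
qed

lemma perm_vec_in_Q: "u \<in> B \<Longrightarrow> pv u \<in> Q"
  unfolding bruhat_polytope_def by (rule hull_inc) blast

lemma inner_le_on_Q:
  assumes "\<And>z. z \<in> B \<Longrightarrow> c \<bullet> pv z \<le> m" and "x \<in> Q"
  shows "c \<bullet> x \<le> m"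
proof -
  have "Q \<subseteq> {x. c \<bullet> x \<le> m}"
    unfolding bruhat_polytope_def by (rule hull_minimal) (use assms(1) convex_halfspace_le in auto)
  then show ?thesis using assms(2) by blast
qed

lemma inner_swap:
  assumes "u \<in> B" "R u a b"
  shows "x \<bullet> pv (u \<circ> Transposition.transpose a b) =
    x \<bullet> pv u + (real b - real a) * (coords x (u a) - coords x (u b))"
proof -
  have "u \<circ> Transposition.transpose a b \<in> B" using assms by (simp add: swap_below_def)
  then show ?thesis
    using inner_perm_vec B_sym_group assms pairing_transpose R_range by metis
qed

lemma max_of_R_monotone:
  assumes "u \<in> B" "\<And>a b. R u a b \<Longrightarrow> coords c (u a) \<le> coords c (u b)" "x \<in> Q"
  shows "c \<bullet> x \<le> c \<bullet> pv u"
proof (rule inner_le_on_Q[OF _ assms(3)])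
  fix z assume z: "z \<in> B"
  show "c \<bullet> pv z \<le> c \<bullet> pv u"
    using local_inequalities_imp_max[where x = "coords c", OF w_perm assms(1) _ z] assms(2)
      inner_perm_vec[OF B_sym_group[OF z]] inner_perm_vec[OF B_sym_group[OF assms(1)]] by simp
qed

text \<open>The inequalities are necessary because each exchange leads to another vertex, and sufficient by
\<open>local_inequalities_imp_max\<close>.\<close>

lemma normal_cone_iff:
  assumes "u \<in> B"
  shows "x \<in> normal_cone Q (pv u) \<longleftrightarrow> (\<forall>a b. R u a b \<longrightarrow> coords x (u a) \<le> coords x (u b))"
proof
  assume "x \<in> normal_cone Q (pv u)"
  then have max: "x \<bullet> y \<le> x \<bullet> pv u" if "y \<in> Q" for y
    using that by (force simp: normal_cone_def is_arg_max_def not_less)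
  show "\<forall>a b. R u a b \<longrightarrow> coords x (u a) \<le> coords x (u b)"
  proof (intro allI impI)
    fix a b assume ab: "R u a b"
    have "u \<circ> Transposition.transpose a b \<in> B" using ab by (simp add: swap_below_def)
    then have "(real b - real a) * (coords x (u a) - coords x (u b)) \<le> 0"
      using max[OF perm_vec_in_Q] inner_swap[OF assms ab, of x] by fastforce
    then show "coords x (u a) \<le> coords x (u b)" using R_range[OF ab] by (simp add: mult_le_0_iff)
  qed
next
  assume "\<forall>a b. R u a b \<longrightarrow> coords x (u a) \<le> coords x (u b)"
  then have "x \<bullet> y \<le> x \<bullet> pv u" if "y \<in> Q" for y
    using max_of_R_monotone[OF assms _ that] by blast
  then show "x \<in> normal_cone Q (pv u)"
    using perm_vec_in_Q[OF assms] by (auto simp: normal_cone_def is_arg_max_def not_less)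
qed

lemma inv_permutation_neq:
  assumes "y \<in> sym_group n" "p \<noteq> q"
  shows "inv y p \<noteq> inv y q"
proof -
  have "y permutes {1..n}" using assms(1) by (simp add: sym_group_def)
  then have "inj (inv y)" using permutes_inv permutes_inj by blast
  then show ?thesis using assms(2) by (simp add: inj_eq)
qed

lemma perm_vec_in_braid_cone:
  assumes "y \<in> sym_group n"
  shows "pv y \<in> braid_cone ix y"
proof -
  have "pv y $ i \<noteq> pv y $ j" if "i \<noteq> j" for i j
  proof -
    have "ix i \<noteq> ix j" using that inv_ix by metis
    then show ?thesis using inv_permutation_neq[OF assms] by (simp add: perm_vec_def)
  qed
  then have "pv y \<in> - \<Union> braid_arrangement" by (auto simp: braid_arrangement_def)
  then have "pv y \<in> connected_component_set (- \<Union> braid_arrangement) (pv y)" by simp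
  then show ?thesis unfolding braid_cone_def using closure_subset by blast
qed

text \<open>On a connected set that avoids the hyperplane where the two coordinates agree, their difference keeps
its sign; the weak inequality survives in the closure.\<close>

lemma braid_cone_monotone:
  assumes "x \<in> braid_cone ix y" "p \<in> {1..n}" "q \<in> {1..n}" "inv y p < inv y q"
  shows "coords x p \<le> coords x q"
proof -
  let ?C = "connected_component_set (- \<Union> braid_arrangement) (pv y)"
  define i j where "i = inv_into UNIV ix p" and "j = inv_into UNIV ix q"
  have ixij: "ix i = p" "ix j = q" using assms ix_inv by (simp_all add: i_def j_def)
  have ne: "i \<noteq> j" using ixij assms(4) by auto
  define a :: "real ^ 'n" where "a = axis i 1 - axis j 1"
  have a: "a \<bullet> x = x $ i - x $ j" for x
    by (simp add: a_def inner_diff_left inner_axis')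
  have "?C \<subseteq> {x. a \<bullet> x \<le> 0}"
  proof
    fix x assume x: "x \<in> ?C"
    then have y: "pv y \<in> ?C" using connected_component_in[of "- \<Union> braid_arrangement" "pv y" x] by simp
    show "x \<in> {x. a \<bullet> x \<le> 0}"
    proof (rule ccontr)
      assume "x \<notin> {x. a \<bullet> x \<le> 0}"
      moreover have "a \<bullet> pv y \<le> 0" using assms(4) ixij by (simp add: a perm_vec_def)
      ultimately obtain z where z: "z \<in> ?C" "a \<bullet> z = 0"
        using connected_ivt_hyperplane[OF connected_connected_component y x, of a 0] by auto
      then have "z \<in> \<Union> braid_arrangement" using ne by (auto simp: a braid_arrangement_def)
      moreover have "z \<in> - \<Union> braid_arrangement" using z(1) connected_component_subset by blast
      ultimately show False by blast
    qed
  qed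
  then have "braid_cone ix y \<subseteq> {x. a \<bullet> x \<le> 0}"
    unfolding braid_cone_def by (rule closure_minimal) (rule closed_halfspace_le)
  then show ?thesis using assms(1) by (auto simp: a coords_def i_def j_def)
qed

lemma braid_cone_subset_normal_cone_iff:
  assumes "u \<in> B" "y \<in> sym_group n"
  shows "braid_cone ix y \<subseteq> normal_cone Q (pv u) \<longleftrightarrow> local_max n w (\<lambda>k. real (inv y k)) u"
proof
  assume "braid_cone ix y \<subseteq> normal_cone Q (pv u)"
  then have mono: "R u a b \<Longrightarrow> coords (pv y) (u a) \<le> coords (pv y) (u b)" for a b
    using normal_cone_iff[OF assms(1)] perm_vec_in_braid_cone[OF assms(2)] by blast
  show "local_max n w (\<lambda>k. real (inv y k)) u"
    unfolding local_max_def
  proof (intro conjI allI impI assms)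
    fix a b assume ab: "R u a b"
    have "u a \<noteq> u b" using inj_sym_group[OF B_sym_group[OF assms(1)]] R_range[OF ab] by (simp add: inj_eq)
    then have "inv y (u a) \<noteq> inv y (u b)" using inv_permutation_neq assms by blast
    then show "real (inv y (u a)) < real (inv y (u b))"
      using mono[OF ab] coords_perm_vec R_values_range[OF assms(1) ab] by auto
  qed
next
  assume lm: "local_max n w (\<lambda>k. real (inv y k)) u"
  show "braid_cone ix y \<subseteq> normal_cone Q (pv u)"
  proof
    fix x assume x: "x \<in> braid_cone ix y"
    have "coords x (u a) \<le> coords x (u b)" if ab: "R u a b" for a b
      using braid_cone_monotone[OF x] R_values_range[OF assms(1) ab] lm ab
      by (simp add: local_max_def)
    then show "x \<in> normal_cone Q (pv u)" using normal_cone_iff assms(1) by blast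
  qed
qed

section \<open>Classes of vertices and their tops\<close>

lemma local_max_self:
  assumes "u \<in> B"
  shows "local_max n w (\<lambda>k. real (inv u k)) u"
  using assms R_range[of u] inj_sym_group[OF B_sym_group[OF assms]]
  by (auto simp: local_max_def)

text \<open>The chamber of \<open>u\<close> lies in the normal cone at the vertex of \<open>u\<close>, and by uniqueness of local maxima in
no other.\<close>

lemma cone_class_eq:
  assumes "u \<in> B"
  shows "cone_class ix n w u = {y \<in> sym_group n. local_max n w (\<lambda>k. real (inv y k)) u}"
proof -
  have "same_cone ix n w u y \<longleftrightarrow> local_max n w (\<lambda>k. real (inv y k)) u" if y: "y \<in> sym_group n" for y
  proof
    assume "same_cone ix n w u y"
    then obtain v where v: "v \<in> B" "braid_cone ix u \<subseteq> normal_cone Q (pv v)"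
        "braid_cone ix y \<subseteq> normal_cone Q (pv v)"
      by (auto simp: same_cone_def)
    then have "local_max n w (\<lambda>k. real (inv u k)) v" "local_max n w (\<lambda>k. real (inv y k)) v"
      using braid_cone_subset_normal_cone_iff B_sym_group[OF assms] y by blast+
    moreover have "v = u"
      using local_max_unique[OF w_perm calculation(1) local_max_self[OF assms]] .
    ultimately show "local_max n w (\<lambda>k. real (inv y k)) u" by simp
  next
    assume "local_max n w (\<lambda>k. real (inv y k)) u"
    then show "same_cone ix n w u y"
      unfolding same_cone_def
      using braid_cone_subset_normal_cone_iff[OF assms] B_sym_group[OF assms] local_max_self[OF assms] y assms
      by blast
  qed
  then show ?thesis by (auto simp: cone_class_def)
qed

lemma class_top_in_cone_class:
  assumes "u \<in> B"
  shows "class_top u \<in> sym_group n" "local_max n w (\<lambda>k. real (inv (class_top u) k)) u"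
proof -
  interpret interval_poset n u "R u" by (rule interval_poset_swap_below[OF assms])
  show "class_top u \<in> sym_group n" unfolding class_top_def by (rule top_perm_in_sym_group)
  show "local_max n w (\<lambda>k. real (inv (class_top u) k)) u"
    unfolding local_max_def class_top_def
  proof (intro conjI allI impI assms)
    fix a b assume ab: "R u a b"
    then have "top_pos a < top_pos b" using P_top_pos_less by blast
    then show "real (inv top_perm (u a)) < real (inv top_perm (u b))"
      using inv_top_perm R_range[OF ab] by simp
  qed
qed

lemma top_elem_eq:
  assumes "u \<in> B"
  shows "top_elem ix n w u = class_top u"
proof -
  interpret interval_poset n u "R u" by (rule interval_poset_swap_below[OF assms])
  have max: "right_weak_le n y (class_top u)" if "y \<in> cone_class ix n w u" for y
  proof -
    have "y \<in> sym_group n" "local_max n w (\<lambda>k. real (inv y k)) u"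
      using that cone_class_eq[OF assms] by auto
    then show ?thesis unfolding class_top_def by (intro right_weak_le_top_perm) (auto simp: local_max_def)
  qed
  have top: "class_top u \<in> cone_class ix n w u" using class_top_in_cone_class[OF assms] cone_class_eq[OF assms] by simp
  show ?thesis unfolding top_elem_def
    by (rule the_equality) (use top max right_weak_le_antisym in blast)+
qed

lemma inj_on_class_top: "inj_on class_top B"
proof (rule inj_onI)
  fix u u' assume "u \<in> B" "u' \<in> B" "class_top u = class_top u'"
  then show "u = u'" using local_max_unique[OF w_perm] class_top_in_cone_class(2) by metis
qed

section \<open>Faces indexed by sets of ascents\<close>

definition ascents :: "(nat \<Rightarrow> nat) \<Rightarrow> nat set" where
  "ascents u = {k. 1 \<le> k \<and> k < n \<and> class_top u k < class_top u (k + 1)}"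

text \<open>At an ascent \<open>k\<close> this is the direction of an edge of the polytope at the vertex of \<open>u\<close>; see
\<open>ascent_swap_vec\<close>.\<close>

definition edge_dir :: "(nat \<Rightarrow> nat) \<Rightarrow> nat \<Rightarrow> real ^ 'n" where
  "edge_dir u k = axis (inv_into UNIV ix (class_top u k)) 1 - axis (inv_into UNIV ix (class_top u (k + 1))) 1"

definition face :: "(nat \<Rightarrow> nat) \<Rightarrow> nat set \<Rightarrow> (real ^ 'n) set" where
  "face u E = Q \<inter> {x. x - pv u \<in> span (edge_dir u ` E)}"

lemma finite_ascents: "finite (ascents u)"
  by (rule finite_subset[of _ "{1..<n}"]) (auto simp: ascents_def)

lemma ascents_subset: "ascents u \<subseteq> {1..<n}"
  by (auto simp: ascents_def)

lemma inner_edge_dir: "x \<bullet> edge_dir u k = coords x (class_top u k) - coords x (class_top u (k + 1))"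
  by (simp add: edge_dir_def coords_def inner_diff_right inner_axis)

text \<open>The indicator vectors of the initial segments of the top of \<open>u\<close> are dual to the edge directions, which
are therefore linearly independent.\<close>

lemma edge_dir_dual_basis:
  assumes "u \<in> B" "m \<in> {1..<n}" "k \<in> {1..<n}"
  shows "vec_of (\<lambda>p. if inv (class_top u) p \<le> m then 1 else 0) \<bullet> edge_dir u k = (if k = m then 1 else 0)"
proof -
  have Tu: "class_top u permutes {1..n}" using class_top_in_cone_class(1)[OF assms(1)] by (simp add: sym_group_def)
  have "class_top u k \<in> {1..n}" "class_top u (k + 1) \<in> {1..n}" using permutes_in_image[OF Tu] assms(3) by auto
  then show ?thesis
    unfolding inner_edge_dir using coords_vec_of permutes_inverses(2)[OF Tu] by auto
qed

lemma edge_dir_in_span_iff: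
  assumes "u \<in> B" "E \<subseteq> {1..<n}" "m \<in> {1..<n}"
  shows "edge_dir u m \<in> span (edge_dir u ` E) \<longleftrightarrow> m \<in> E"
proof
  assume span: "edge_dir u m \<in> span (edge_dir u ` E)"
  show "m \<in> E"
  proof (rule ccontr)
    assume m: "m \<notin> E"
    let ?g = "vec_of (\<lambda>p. if inv (class_top u) p \<le> m then 1 else 0) :: real ^ 'n"
    have "orthogonal ?g y" if "y \<in> edge_dir u ` E" for y
      using that edge_dir_dual_basis[OF assms(1,3)] assms(2) m by (auto simp: orthogonal_def)
    then have "orthogonal ?g (edge_dir u m)" using orthogonal_to_span span by blast
    then show False using edge_dir_dual_basis[OF assms(1,3,3)] by (simp add: orthogonal_def)
  qed
qed (simp add: span_base)

lemma inj_on_edge_dir: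
  assumes "u \<in> B"
  shows "inj_on (edge_dir u) {1..<n}"
proof (rule inj_onI)
  fix k m assume km: "k \<in> {1..<n}" "m \<in> {1..<n}" "edge_dir u k = edge_dir u m"
  then have "edge_dir u k \<in> span (edge_dir u ` {m})" by (simp add: span_base)
  then show "k = m" using edge_dir_in_span_iff[OF assms, of "{m}" k] km by simp
qed

lemma dim_span_edge_dir:
  assumes "u \<in> B" "E \<subseteq> {1..<n}"
  shows "dim (span (edge_dir u ` E)) = card E"
proof -
  have "independent (edge_dir u ` E)"
    unfolding dependent_def
  proof clarify
    fix m assume m: "m \<in> E" "edge_dir u m \<in> span (edge_dir u ` E - {edge_dir u m})"
    have "edge_dir u ` E - {edge_dir u m} \<subseteq> edge_dir u ` (E - {m})" by auto
    then have "edge_dir u m \<in> span (edge_dir u ` (E - {m}))" using m(2) span_mono by blast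
    moreover have "E - {m} \<subseteq> {1..<n}" "m \<in> {1..<n}" using assms(2) m(1) by blast+
    ultimately show False using edge_dir_in_span_iff[OF assms(1)] by blast
  qed
  then have "dim (edge_dir u ` E) = card (edge_dir u ` E)" by (rule dim_eq_card_independent)
  also have "\<dots> = card E" using inj_on_subset[OF inj_on_edge_dir[OF assms(1)] assms(2)] by (rule card_image)
  finally show ?thesis by (simp add: dim_span)
qed

lemma ascent_imp_swap:
  assumes "u \<in> B" "k \<in> ascents u"
  obtains a b where "R u a b" "class_top u k = u a" "class_top u (k + 1) = u b"
proof -
  interpret interval_poset n u "R u" by (rule interval_poset_swap_below[OF assms(1)])
  let ?a = "inv_into {1..n} top_pos k" and ?b = "inv_into {1..n} top_pos (k + 1)"
  have k: "k \<in> {1..n}" "k + 1 \<in> {1..n}" using assms(2) by (auto simp: ascents_def)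
  have Tk: "class_top u k = u ?a" "class_top u (k + 1) = u ?b"
    unfolding class_top_def using k by (simp_all only: top_perm_def if_True)
  have "R u ?a ?b"
    using adjacent_ascent_imp_R[OF entry_range[OF k(1)] entry_range[OF k(2)]]
      top_pos_entry[OF k(1)] top_pos_entry[OF k(2)] Tk assms(2) by (simp add: ascents_def)
  then show thesis using that Tk by blast
qed

lemma ascent_swap_vec:
  assumes "u \<in> B" "k \<in> ascents u"
  obtains z r where "z \<in> B" "0 < r" "pv z - pv u = r *\<^sub>R edge_dir u k"
proof -
  obtain a b where ab: "R u a b" "class_top u k = u a" "class_top u (k + 1) = u b"
    using ascent_imp_swap[OF assms] by blast
  let ?z = "u \<circ> Transposition.transpose a b"
  have "x \<bullet> (pv ?z - pv u) = x \<bullet> ((real b - real a) *\<^sub>R edge_dir u k)" for x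
    using inner_swap[OF assms(1) ab(1), of x] inner_edge_dir[of x u k] ab
    by (simp add: inner_diff_right)
  then have "pv ?z - pv u = (real b - real a) *\<^sub>R edge_dir u k"
    using vector_eq_ldot by blast
  moreover have "?z \<in> B" "0 < real b - real a" using ab(1) by (auto simp: swap_below_def)
  ultimately show thesis using that by blast
qed

text \<open>Together with \<open>u\<close>, these ascents determine the face on which \<open>c\<close> is maximal; see \<open>max_face_eq\<close>.\<close>

definition tight :: "real ^ 'n \<Rightarrow> (nat \<Rightarrow> nat) \<Rightarrow> nat set" where
  "tight c u = {k \<in> ascents u. coords c (class_top u k) = coords c (class_top u (k + 1))}"

text \<open>The functional \<open>c\<close> is maximal at the vertex of \<open>u\<close>, and ties are broken by index: equal coordinates are
treated as increasing. Equivalently, \<open>u\<close> is the local maximum for \<open>c\<close> plus a small multiple of the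
vector of the identity, so it is the vertex closest to the identity on the face where \<open>c\<close> is maximal.\<close>

definition lowest_max :: "real ^ 'n \<Rightarrow> (nat \<Rightarrow> nat) \<Rightarrow> bool" where
  "lowest_max c u \<longleftrightarrow> u \<in> B \<and> (\<forall>a b. R u a b \<longrightarrow>
     coords c (u a) \<le> coords c (u b) \<and> (coords c (u a) = coords c (u b) \<longrightarrow> u a < u b))"

lemma tight_subset: "tight c u \<subseteq> ascents u" "tight c u \<subseteq> {1..<n}"
  using ascents_subset by (auto simp: tight_def)

lemma equal_on_tight_imp_equal:
  assumes "lowest_max c u" "R u a b" "coords c (u a) = coords c (u b)"
    and "\<And>k. k \<in> tight c u \<Longrightarrow> f (class_top u k) = f (class_top u (k + 1))"
  shows "f (u a) = f (u b)"
proof -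
  have u: "u \<in> B" using assms(1) by (simp add: lowest_max_def)
  interpret interval_poset n u "R u" by (rule interval_poset_swap_below[OF u])
  have rng: "a \<in> {1..n}" "b \<in> {1..n}" using R_range[OF assms(2)] by auto
  have pos: "top_pos a < top_pos b" using P_top_pos_less assms(2) by blast
  have tight: "k \<in> tight c u" if k: "top_pos a \<le> k" "k < top_pos b" for k
  proof -
    have "top_perm k < top_perm (k + 1) \<and> coords c (top_perm k) = coords c (top_perm (k + 1))"
      by (rule ascent_run_of_equality[where a = a and b = b])
        (use assms k in \<open>auto simp: lowest_max_def\<close>)
    then show ?thesis
      using k top_pos_range[OF rng(1)] top_pos_range[OF rng(2)]
      by (simp add: tight_def ascents_def class_top_def)
  qed
  have "f (class_top u (top_pos a)) = f (class_top u k)" if "top_pos a \<le> k" "k \<le> top_pos b" for k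
    using that
  proof (induction k rule: dec_induct)
    case base
    then show ?case by simp
  next
    case (step k)
    then show ?case using assms(4)[OF tight[of k]] by simp
  qed
  from this[of "top_pos b"] show ?thesis
    using pos top_perm_top_pos[OF rng(1)] top_perm_top_pos[OF rng(2)] by (simp add: class_top_def)
qed

lemma lowest_max_is_max:
  assumes "lowest_max c u" "x \<in> Q"
  shows "c \<bullet> x \<le> c \<bullet> pv u"
  by (rule max_of_R_monotone) (use assms in \<open>auto simp: lowest_max_def\<close>)

text \<open>Any \<open>g\<close> orthogonal to the tight edge directions can be added to \<open>c\<close> with a small positive coefficient
without violating the inequalities of the normal cone at \<open>u\<close>: strict ones survive, and a relation on
which \<open>c\<close> is constant is a run of tight ascents, along which \<open>g\<close> is constant too. So \<open>g\<close> is
nonpositive on \<open>x - pv u\<close> for every point \<open>x\<close> of the face. Applying this to both signs of the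
component of \<open>x - pv u\<close> orthogonal to the tight directions shows that this component vanishes.\<close>

lemma max_face_eq:
  assumes "lowest_max c u"
  shows "Q \<inter> {x. c \<bullet> x = c \<bullet> pv u} = face u (tight c u)"
proof
  have u: "u \<in> B" using assms by (simp add: lowest_max_def)
  show "face u (tight c u) \<subseteq> Q \<inter> {x. c \<bullet> x = c \<bullet> pv u}"
  proof
    fix x assume x: "x \<in> face u (tight c u)"
    have "orthogonal c y" if "y \<in> edge_dir u ` tight c u" for y
      using that by (auto simp: orthogonal_def inner_edge_dir tight_def)
    then have "orthogonal c (x - pv u)" using x orthogonal_to_span unfolding face_def by blast
    then show "x \<in> Q \<inter> {x. c \<bullet> x = c \<bullet> pv u}"
      using x by (simp add: face_def orthogonal_def inner_diff_right)
  qed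
  show "Q \<inter> {x. c \<bullet> x = c \<bullet> pv u} \<subseteq> face u (tight c u)"
  proof
    fix x assume "x \<in> Q \<inter> {x. c \<bullet> x = c \<bullet> pv u}"
    then have x: "x \<in> Q" "c \<bullet> x = c \<bullet> pv u" by auto
    \<comment> \<open>Here \<open>z\<close> is the component orthogonal to the tight directions, to be shown zero.\<close>
    obtain y z where yz: "y \<in> span (edge_dir u ` tight c u)"
        "\<And>v. v \<in> span (edge_dir u ` tight c u) \<Longrightarrow> orthogonal z v" "x - pv u = y + z"
      using orthogonal_subspace_decomp_exists[of "edge_dir u ` tight c u" "x - pv u"] by blast
    have nonpos: "g \<bullet> (x - pv u) \<le> 0"
      if g: "\<And>v. v \<in> span (edge_dir u ` tight c u) \<Longrightarrow> orthogonal g v" for g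
    proof -
      obtain e :: real where e: "0 < e"
        "\<forall>p\<in>{1..n}. \<forall>q\<in>{1..n}. coords c p < coords c q \<longrightarrow>
           coords c p + e * coords g p < coords c q + e * coords g q"
        using eventually_happens'[OF _ eventually_conj[OF eventually_at_right_less[of "0 :: real"]
          eventually_perturbation_keeps_less[of n "coords c" "coords g"]]] by auto
      have g_tight: "coords g (class_top u k) = coords g (class_top u (k + 1))" if "k \<in> tight c u" for k
        using g[OF span_base, of "edge_dir u k"] that by (simp add: orthogonal_def inner_edge_dir)
      have "(c + e *\<^sub>R g) \<bullet> x \<le> (c + e *\<^sub>R g) \<bullet> pv u"
      proof (rule max_of_R_monotone[OF u _ x(1)])
        fix a b assume ab: "R u a b"
        have rng: "u a \<in> {1..n}" "u b \<in> {1..n}" using R_values_range[OF u ab] by auto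
        have "coords c (u a) \<le> coords c (u b)" using assms ab by (simp add: lowest_max_def)
        then consider "coords c (u a) < coords c (u b)" | "coords c (u a) = coords c (u b)" by linarith
        then show "coords (c + e *\<^sub>R g) (u a) \<le> coords (c + e *\<^sub>R g) (u b)"
        proof cases
          case 1
          then have "coords c (u a) + e * coords g (u a) < coords c (u b) + e * coords g (u b)"
            using e(2) rng by blast
          then show ?thesis by (simp add: coords_add_scaled)
        next
          case 2
          then have "coords g (u a) = coords g (u b)"
            using equal_on_tight_imp_equal[OF assms ab] g_tight by blast
          then show ?thesis using 2 by (simp add: coords_add_scaled)
        qed
      qed
      then have "e * (g \<bullet> (x - pv u)) \<le> 0"
        using x(2) by (simp add: inner_add_left inner_diff_right algebra_simps)
      then show ?thesis using e(1) by (simp add: mult_le_0_iff)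
    qed
    have "z \<bullet> (x - pv u) = 0"
      using nonpos[of z] nonpos[of "- z"] yz(2) by (force simp: orthogonal_def)
    moreover have "z \<bullet> y = 0" using yz(1,2) by (simp add: orthogonal_def)
    ultimately have "z = 0" using yz(3) by (simp add: inner_add_right)
    then show "x \<in> face u (tight c u)" using x(1) yz by (simp add: face_def)
  qed
qed

lemma tie_breaking_perturbation:
  obtains e where "0 < e" "inj_on (\<lambda>p. coords c p + e * real p) {1..n}"
    "\<And>p q. \<lbrakk>p \<in> {1..n}; q \<in> {1..n}; coords c p < coords c q\<rbrakk>
       \<Longrightarrow> coords c p + e * real p < coords c q + e * real q"
proof -
  obtain e :: real where e: "0 < e"
    "\<forall>p\<in>{1..n}. \<forall>q\<in>{1..n}. coords c p < coords c q \<longrightarrow>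
       coords c p + e * real p < coords c q + e * real q"
    using eventually_happens'[OF _ eventually_conj[OF eventually_at_right_less[of "0 :: real"]
      eventually_perturbation_keeps_less[of n "coords c" real]]] by auto
  have "inj_on (\<lambda>p. coords c p + e * real p) {1..n}"
  proof (rule inj_onI)
    fix p q assume pq: "p \<in> {1..n}" "q \<in> {1..n}" "coords c p + e * real p = coords c q + e * real q"
    then have "\<not> coords c p < coords c q" "\<not> coords c q < coords c p"
      using e(2) by (metis less_irrefl)+
    then show "p = q" using pq(3) e(1) by simp
  qed
  then show thesis using that e by blast
qed

lemma lowest_max_exists:
  obtains u where "lowest_max c u"
proof -
  obtain e where e: "0 < e" "inj_on (\<lambda>p. coords c p + e * real p) {1..n}"
    "\<And>p q. \<lbrakk>p \<in> {1..n}; q \<in> {1..n}; coords c p < coords c q\<rbrakk>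
       \<Longrightarrow> coords c p + e * real p < coords c q + e * real q"
    using tie_breaking_perturbation by blast
  let ?x = "\<lambda>p. coords c p + e * real p"
  obtain u where u: "local_max n w ?x u" using local_max_exists[OF w_perm e(2)] by blast
  then have uB: "u \<in> B" by (simp add: local_max_def)
  have "coords c (u a) \<le> coords c (u b) \<and> (coords c (u a) = coords c (u b) \<longrightarrow> u a < u b)"
    if ab: "R u a b" for a b
  proof -
    have less: "?x (u a) < ?x (u b)" using u ab by (simp add: local_max_def)
    have "\<not> coords c (u b) < coords c (u a)"
      using e(3)[of "u b" "u a"] R_values_range[OF uB ab] less by force
    then show ?thesis using less e(1) by auto
  qed
  then have "lowest_max c u" using uB by (simp add: lowest_max_def)
  then show thesis by (rule that)
qed

lemma lowest_max_perturbed: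
  assumes "lowest_max c u"
  obtains e where "0 < e" "inj_on (\<lambda>p. coords c p + e * real p) {1..n}"
    "local_max n w (\<lambda>p. coords c p + e * real p) u"
proof -
  obtain e where e: "0 < e" "inj_on (\<lambda>p. coords c p + e * real p) {1..n}"
    "\<And>p q. \<lbrakk>p \<in> {1..n}; q \<in> {1..n}; coords c p < coords c q\<rbrakk>
       \<Longrightarrow> coords c p + e * real p < coords c q + e * real q"
    using tie_breaking_perturbation by blast
  let ?x = "\<lambda>p. coords c p + e * real p"
  have uB: "u \<in> B" using assms by (simp add: lowest_max_def)
  have "?x (u a) < ?x (u b)" if ab: "R u a b" for a b
  proof (cases "coords c (u a) = coords c (u b)")
    case True
    then show ?thesis using assms ab e(1) by (simp add: lowest_max_def)
  next
    case False
    then have "coords c (u a) < coords c (u b)" using assms ab by (force simp: lowest_max_def)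
    then show ?thesis using e(3) R_values_range[OF uB ab] by blast
  qed
  then have "local_max n w ?x u" using uB by (simp add: local_max_def)
  then show thesis using that e(1,2) by blast
qed

text \<open>On the face, \<open>u\<close> maximizes the inner product with the vector of the identity, and so does \<open>u'\<close>; by the
uniqueness of local maxima they coincide.\<close>

lemma lowest_max_unique_of_face:
  assumes "lowest_max c u" "lowest_max c' u'"
    and "Q \<inter> {x. c \<bullet> x = c \<bullet> pv u} = Q \<inter> {x. c' \<bullet> x = c' \<bullet> pv u'}"
  shows "u = u'"
proof -
  have *: "pairing n real u' \<le> pairing n real u \<and>
      (pairing n real u' = pairing n real u \<longrightarrow> u' = u)"
    if lm: "lowest_max c u" and v: "u' \<in> B" "c \<bullet> pv u' = c \<bullet> pv u" for c u u'
  proof -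
    obtain e where e: "0 < e" "inj_on (\<lambda>p. coords c p + e * real p) {1..n}"
      "local_max n w (\<lambda>p. coords c p + e * real p) u"
      using lowest_max_perturbed[OF lm] by blast
    let ?x = "\<lambda>p. coords c p + e * real p"
    have u: "u \<in> B" using lm by (simp add: lowest_max_def)
    have max: "pairing n ?x z \<le> pairing n ?x u" if "z \<in> B" for z
      using local_max_is_max[OF w_perm e(2,3) that] .
    have c: "pairing n (coords c) u' = pairing n (coords c) u"
      using v(2) inner_perm_vec B_sym_group u v(1) by metis
    have "pairing n ?x u' \<le> pairing n ?x u" using max v(1) .
    then have "e * pairing n real u' \<le> e * pairing n real u" unfolding pairing_add c by linarith
    then have le: "pairing n real u' \<le> pairing n real u" using e(1) by simp
    have "u' = u" if eq: "pairing n real u' = pairing n real u"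
    proof -
      have "pairing n ?x u' = pairing n ?x u" unfolding pairing_add c eq ..
      then have "local_max n w ?x u'" using local_max_of_max[OF e(2) v(1)] max by simp
      then show ?thesis using local_max_unique[OF w_perm _ e(3)] by blast
    qed
    with le show ?thesis by blast
  qed
  have uB: "u \<in> B" "u' \<in> B" using assms by (simp_all add: lowest_max_def)
  have "pv u' \<in> Q \<inter> {x. c \<bullet> x = c \<bullet> pv u}" using assms(3) perm_vec_in_Q[OF uB(2)] by blast
  then have 1: "c \<bullet> pv u' = c \<bullet> pv u" by blast
  have "pv u \<in> Q \<inter> {x. c' \<bullet> x = c' \<bullet> pv u'}" using assms(3) perm_vec_in_Q[OF uB(1)] by blast
  then have 2: "c' \<bullet> pv u = c' \<bullet> pv u'" by blast
  show ?thesis using *[OF assms(1) uB(2) 1] *[OF assms(2) uB(1) 2] by auto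
qed

text \<open>Number the entries of the top of \<open>u\<close> so that the number increases by one exactly at the adjacent pairs
outside \<open>E\<close>. Entries with the same number form a run of ascents in \<open>E\<close>.\<close>

lemma functional_with_tight_set:
  assumes "u \<in> B" "E \<subseteq> ascents u"
  obtains c where "lowest_max c u" "tight c u = E"
proof -
  interpret interval_poset n u "R u" by (rule interval_poset_swap_below[OF assms(1)])
  define breaks where "breaks i = {j. 1 \<le> j \<and> j < i \<and> j \<notin> E}" for i
  define c :: "real ^ 'n" where "c = vec_of (\<lambda>p. real (card (breaks (inv (class_top u) p))))"
  have fin: "finite (breaks i)" for i by (rule finite_subset[of _ "{..<i}"]) (auto simp: breaks_def)
  have mono: "breaks i \<subseteq> breaks j" if "i \<le> j" for i j using that by (auto simp: breaks_def)
  have Tu: "class_top u permutes {1..n}" using class_top_in_cone_class(1)[OF assms(1)] by (simp add: sym_group_def)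
  have cT: "coords c (class_top u i) = real (card (breaks i))" if "i \<in> {1..n}" for i
    using that permutes_in_image[OF Tu] coords_vec_of permutes_inverses(2)[OF Tu] by (simp add: c_def)
  have eq_iff: "card (breaks i) = card (breaks j) \<longleftrightarrow> breaks i = breaks j" if "i \<le> j" for i j
    using card_subset_eq[OF fin mono[OF that]] by auto
  have "coords c (u a) \<le> coords c (u b) \<and> (coords c (u a) = coords c (u b) \<longrightarrow> u a < u b)"
    if ab: "R u a b" for a b
  proof -
    have rng: "a \<in> {1..n}" "b \<in> {1..n}" using R_range[OF ab] by auto
    have pos: "top_pos a < top_pos b" using P_top_pos_less ab by blast
    have Tpos: "class_top u (top_pos a) = u a" "class_top u (top_pos b) = u b"
      using top_perm_top_pos rng by (simp_all only: class_top_def)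
    have ca: "coords c (u a) = real (card (breaks (top_pos a)))"
      "coords c (u b) = real (card (breaks (top_pos b)))"
      using cT[OF top_pos_range[OF rng(1)]] cT[OF top_pos_range[OF rng(2)]] Tpos by simp_all
    have "u a < u b" if same: "breaks (top_pos a) = breaks (top_pos b)"
    proof -
      have E: "j \<in> E" if "top_pos a \<le> j" "j < top_pos b" for j
      proof (rule ccontr)
        assume "j \<notin> E"
        then have "j \<in> breaks (top_pos b)"
          using that top_pos_range[OF rng(1)] by (simp add: breaks_def)
        then have "j \<in> breaks (top_pos a)" unfolding same .
        then show False using that(1) by (simp add: breaks_def)
      qed
      have "class_top u (top_pos a) < class_top u j" if "top_pos a + 1 \<le> j" "j \<le> top_pos b" for j
        using that
      proof (induction j rule: dec_induct)
        case base
        then show ?case using E[of "top_pos a"] assms(2) by (auto simp: ascents_def)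
      next
        case (step j)
        then have "class_top u j < class_top u (j + 1)" using E[of j] assms(2) by (auto simp: ascents_def)
        then show ?case using step by simp
      qed
      from this[of "top_pos b"] show ?thesis using pos Tpos by simp
    qed
    moreover have "card (breaks (top_pos a)) \<le> card (breaks (top_pos b))"
      using card_mono[OF fin mono] pos by simp
    ultimately show ?thesis using ca eq_iff[of "top_pos a" "top_pos b"] pos by simp
  qed
  then have "lowest_max c u" using assms(1) by (simp add: lowest_max_def)
  moreover have "tight c u = E"
  proof -
    have "coords c (class_top u k) = coords c (class_top u (k + 1)) \<longleftrightarrow> k \<in> E" if "k \<in> ascents u" for k
    proof -
      have "k \<in> {1..n}" "k + 1 \<in> {1..n}" "1 \<le> k" using that by (auto simp: ascents_def)
      then have "coords c (class_top u k) = coords c (class_top u (k + 1)) \<longleftrightarrow> breaks k = breaks (k + 1)"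
        using cT[of k] cT[of "k + 1"] eq_iff[of k "k + 1"] by simp
      also have "\<dots> \<longleftrightarrow> k \<in> E"
      proof
        assume same: "breaks k = breaks (k + 1)"
        have "k \<notin> breaks k" by (simp add: breaks_def)
        then have "k \<notin> breaks (k + 1)" unfolding same .
        then show "k \<in> E" using \<open>1 \<le> k\<close> by (simp add: breaks_def)
      next
        assume "k \<in> E"
        then show "breaks k = breaks (k + 1)" by (auto simp: breaks_def less_Suc_eq)
      qed
      finally show ?thesis .
    qed
    then show ?thesis using assms(2) by (auto simp: tight_def)
  qed
  ultimately show thesis using that by blast
qed

lemma face_contains_vertex: "u \<in> B \<Longrightarrow> pv u \<in> face u E"
  by (simp add: face_def perm_vec_in_Q span_zero)

lemma face_is_face:
  assumes "u \<in> B" "E \<subseteq> ascents u"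
  shows "face u E face_of Q"
proof -
  obtain c where c: "lowest_max c u" "tight c u = E"
    using functional_with_tight_set[OF assms] by blast
  have "Q \<inter> {x. c \<bullet> x = c \<bullet> pv u} face_of Q"
    by (rule face_of_Int_supporting_hyperplane_le)
      (use lowest_max_is_max[OF c(1)] in \<open>auto simp: bruhat_polytope_def convex_convex_hull\<close>)
  then show ?thesis using max_face_eq[OF c(1)] c(2) by simp
qed

text \<open>Every face of a polytope is exposed, so it is the face where some functional is maximal.\<close>

lemma face_cases:
  assumes "F face_of Q" "F \<noteq> {}"
  obtains u E where "u \<in> B" "E \<subseteq> ascents u" "F = face u E"
proof -
  have "polytope Q"
    unfolding bruhat_polytope_def by (intro polytope_convex_hull finite_imageI finite_bruhat_below)
  then have "F exposed_face_of Q"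
    using exposed_face_of_polyhedron polytope_imp_polyhedron assms(1) by blast
  then obtain c b where cb: "Q \<subseteq> {x. c \<bullet> x \<le> b}" "F = Q \<inter> {x. c \<bullet> x = b}"
    by (auto simp: exposed_face_of_def)
  obtain u where u: "lowest_max c u" using lowest_max_exists by blast
  then have uB: "u \<in> B" by (simp add: lowest_max_def)
  obtain x where "x \<in> F" using assms(2) by blast
  then have "b \<le> c \<bullet> pv u" using cb(2) lowest_max_is_max[OF u, of x] by auto
  moreover have "c \<bullet> pv u \<le> b" using cb(1) perm_vec_in_Q[OF uB] by blast
  ultimately have "F = face u (tight c u)" using max_face_eq[OF u] cb(2) by simp
  then show thesis using that uB tight_subset by blast
qed

text \<open>Each direction in \<open>E\<close> is realised by an exchange of entries, whose vertex lies on the face.\<close>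

lemma aff_dim_face:
  assumes "u \<in> B" "E \<subseteq> ascents u"
  shows "aff_dim (face u E) = int (card E)"
proof -
  let ?V = "(\<lambda>x. - pv u + x) ` face u E"
  have E: "E \<subseteq> {1..<n}" using assms(2) ascents_subset by blast
  have "?V \<subseteq> span (edge_dir u ` E)" by (auto simp: face_def)
  then have "span ?V \<subseteq> span (edge_dir u ` E)" by (metis span_minimal subspace_span)
  moreover have "edge_dir u k \<in> span ?V" if k: "k \<in> E" for k
  proof -
    obtain z r where z: "z \<in> B" "0 < r" "pv z - pv u = r *\<^sub>R edge_dir u k"
      using ascent_swap_vec[OF assms(1) subsetD[OF assms(2) k]] by blast
    have "pv z \<in> face u E"
      using z k perm_vec_in_Q by (simp add: face_def span_base span_scale)
    then have "r *\<^sub>R edge_dir u k \<in> span ?V"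
      using z(3) by (intro span_base) (auto simp: image_iff intro!: bexI[of _ "pv z"])
    then have "(1 / r) *\<^sub>R (r *\<^sub>R edge_dir u k) \<in> span ?V" by (rule span_scale)
    then show ?thesis using z(2) by simp
  qed
  then have "span (edge_dir u ` E) \<subseteq> span ?V"
    by (intro span_minimal subspace_span) auto
  ultimately have "dim ?V = card E"
    using dim_span_edge_dir[OF assms(1) E] by (metis dim_span subset_antisym)
  moreover have "aff_dim (face u E) = int (dim ?V)"
    by (rule aff_dim_eq_dim) (rule hull_inc[OF face_contains_vertex[OF assms(1)]])
  ultimately show ?thesis by simp
qed

lemma face_inject:
  assumes "u \<in> B" "E \<subseteq> ascents u" "u' \<in> B" "E' \<subseteq> ascents u'" "face u E = face u' E'"
  shows "u = u' \<and> E = E'"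
proof -
  obtain c where c: "lowest_max c u" "tight c u = E"
    using functional_with_tight_set[OF assms(1,2)] by blast
  obtain c' where c': "lowest_max c' u'" "tight c' u' = E'"
    using functional_with_tight_set[OF assms(3,4)] by blast
  have uu: "u = u'"
    by (rule lowest_max_unique_of_face[OF c(1) c'(1)])
      (use max_face_eq[OF c(1)] max_face_eq[OF c'(1)] c(2) c'(2) assms(5) in simp)
  have sub: "E \<subseteq> E'"
    if E: "E \<subseteq> ascents u" "E' \<subseteq> ascents u" and eq: "face u E = face u E'" for E E'
  proof
    fix k assume k: "k \<in> E"
    obtain z r where z: "z \<in> B" "0 < r" "pv z - pv u = r *\<^sub>R edge_dir u k"
      using ascent_swap_vec[OF assms(1) subsetD[OF E(1) k]] by blast
    have "pv z \<in> face u E"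
      using z k perm_vec_in_Q by (simp add: face_def span_base span_scale)
    then have "pv z \<in> face u E'" unfolding eq .
    then have "r *\<^sub>R edge_dir u k \<in> span (edge_dir u ` E')" using z(3) by (simp add: face_def)
    then have "(1 / r) *\<^sub>R (r *\<^sub>R edge_dir u k) \<in> span (edge_dir u ` E')" by (rule span_scale)
    then have "edge_dir u k \<in> span (edge_dir u ` E')" using z(2) by simp
    moreover have "E' \<subseteq> {1..<n}" "k \<in> {1..<n}" using ascents_subset E k by blast+
    ultimately show "k \<in> E'" using edge_dir_in_span_iff[OF assms(1)] by blast
  qed
  show ?thesis using uu sub[of E E'] sub[of E' E] assms by auto
qed

section \<open>The h-vector\<close>

lemma card_faces_of_dim:
  "face_number Q i = card {p \<in> Sigma B (\<lambda>u. Pow (ascents u)). card (snd p) = i}"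
proof -
  have "bij_betw (\<lambda>(u, E). face u E) {p \<in> Sigma B (\<lambda>u. Pow (ascents u)). card (snd p) = i}
    {F. F face_of Q \<and> aff_dim F = int i}"
    unfolding bij_betw_def
  proof
    show "inj_on (\<lambda>(u, E). face u E) {p \<in> Sigma B (\<lambda>u. Pow (ascents u)). card (snd p) = i}"
      using face_inject by (auto simp: inj_on_def)
    show "(\<lambda>(u, E). face u E) ` {p \<in> Sigma B (\<lambda>u. Pow (ascents u)). card (snd p) = i} =
      {F. F face_of Q \<and> aff_dim F = int i}" (is "?L = ?R")
    proof
      show "?L \<subseteq> ?R" using face_is_face aff_dim_face by auto
      show "?R \<subseteq> ?L"
      proof
        fix F assume F: "F \<in> ?R"
        then have "F \<noteq> {}" by auto
        then obtain u E where uE: "u \<in> B" "E \<subseteq> ascents u" "F = face u E"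
          using F face_cases by blast
        then have "card E = i" using F aff_dim_face by simp
        then show "F \<in> ?L" using uE by (intro image_eqI[of _ _ "(u, E)"]) auto
      qed
    qed
  qed
  from bij_betw_same_card[OF this] show ?thesis unfolding face_number_def by (rule sym)
qed

text \<open>The faces with lowest vertex \<open>u\<close> correspond to the subsets of its ascents, and the sum of \<open>(x - 1) ^ card E\<close>
over the subsets \<open>E\<close> of a set of size \<open>m\<close> is \<open>x ^ m\<close> by the binomial theorem.\<close>

lemma h_polynomial_eq: "h_polynomial Q = (\<Sum>u\<in>B. monom 1 (card (ascents u)))"
proof -
  let ?q = "[:-1, 1:] :: int poly"
  let ?I = "Sigma B (\<lambda>u. Pow (ascents u))"
  have finI: "finite ?I" using finite_bruhat_below finite_ascents by blast
  have "card (snd p) \<le> DIM(real ^ 'n)" if "p \<in> ?I" for p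
  proof -
    have "snd p \<subseteq> {1..<n}" using that ascents_subset by fastforce
    then have "card (snd p) \<le> card {1..<n}" by (intro card_mono) auto
    then show ?thesis using card_index by simp
  qed
  then have rng: "(card \<circ> snd) ` ?I \<subseteq> {..DIM(real ^ 'n)}" by auto
  have "h_polynomial Q = (\<Sum>i\<le>DIM(real ^ 'n). \<Sum>p\<in>{p \<in> ?I. (card \<circ> snd) p = i}. ?q ^ card (snd p))"
    unfolding h_polynomial_def card_faces_of_dim by (intro sum.cong) auto
  also have "\<dots> = (\<Sum>p\<in>?I. ?q ^ card (snd p))"
    by (rule sum.group[OF finI _ rng]) simp
  also have "\<dots> = (\<Sum>u\<in>B. \<Sum>E\<in>Pow (ascents u). ?q ^ card E)"
    using finite_bruhat_below finite_ascents by (subst sum.Sigma) (auto simp: case_prod_beta)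
  also have "\<dots> = (\<Sum>u\<in>B. monom 1 (card (ascents u)))"
  proof (rule sum.cong[OF refl])
    fix u
    have "(\<Sum>E\<in>Pow (ascents u). ?q ^ card E) = (\<Prod>k\<in>ascents u. ?q + 1)"
      using prod_add[OF finite_ascents, of "\<lambda>_. ?q" "\<lambda>_. 1" u] by simp
    also have "?q + 1 = monom 1 1" by (simp add: monom_altdef one_pCons)
    finally show "(\<Sum>E\<in>Pow (ascents u). ?q ^ card E) = monom 1 (card (ascents u))"
      by (simp add: monom_power)
  qed
  finally show ?thesis .
qed

lemma h_vector_eq:
  "h_vector Q k = int (card {z \<in> top_elem ix n w ` B. asc n z = k})"
proof -
  have asc: "asc n (class_top u) = card (ascents u)" if "u \<in> B" for u
    using asc_eq_card_ascents[OF class_top_in_cone_class(1)[OF that]] by (simp add: ascents_def)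
  have "h_vector Q k = (\<Sum>u\<in>B. if card (ascents u) = k then 1 else 0)"
    by (simp add: h_vector_def h_polynomial_eq coeff_sum)
  also have "\<dots> = int (card {u \<in> B. card (ascents u) = k})"
    using finite_bruhat_below by (simp add: sum.If_cases Int_def)
  also have "card {u \<in> B. card (ascents u) = k} = card (class_top ` {u \<in> B. card (ascents u) = k})"
    by (rule card_image[symmetric]) (use inj_on_class_top in \<open>auto simp: inj_on_def\<close>)
  also have "class_top ` {u \<in> B. card (ascents u) = k} = {z \<in> top_elem ix n w ` B. asc n z = k}"
    using asc top_elem_eq by (auto simp: image_iff)
  finally show ?thesis .
qed

end

theorem corollary5p5:
  fixes n k :: nat
    and ix :: "'n::finite \<Rightarrow> nat"
    and w :: "nat \<Rightarrow> nat"
  assumes "bij_betw ix (UNIV :: 'n set) {1..n}"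
    and "w \<in> sym_group n"
  shows "h_vector (bruhat_polytope ix n w) k =
           int (card {z \<in> top_elem ix n w ` bruhat_below n w. asc n z = k})"
proof -
  interpret bruhat_polytope_coords ix n w using assms by unfold_locales
  show ?thesis by (rule h_vector_eq)
qed

end
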